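(* Let $d\geq 3$ be an integer and let $\tau,\tau^{*}\in\mathbb{K}$. Then the following (i), (ii) are equivalent. (i) There exists a totally almost bipartite Leonard pair $A,A^{*}$ of Bannai/Ito type with diameter $d$, $\mathrm{tr}(A)=\tau$ and $\mathrm{tr}(A^{*})=\tau^{*}$. (ii) The scalars $\tau,\tau^{*}$ are nonzero. Moreover, if (i), (ii) hold, then the Leonard pair in (i) is unique up to isomorphism of Leonard pairs.
   Context: $\mathbb{K}$ is an algebraically closed field of characteristic zero. A square matrix is tridiagonal if every nonzero entry lies on the diagonal, subdiagonal or superdiagonal; a tridiagonal matrix is irreducible if every subdiagonal and superdiagonal entry is nonzero. A tridiagonal matrix $B$ with rows and columns indexed by $0,\dots,d$ is almost bipartite if exactly one of $B_{00},B_{dd}$ is nonzero and $B_{ii}=0$ for $1\le i\le d-1$. Let $V$ be a $\mathbb{K}$-vector space of finite positive dimension. A Leonard pair on $V$ is an ordered pair of linear maps $A,A^*:V\to V$ such that (1) there is a basis $\{v_i\}_{i=0}^d$ of $V$ in which $A$ is diagonal and $A^*$ is irreducible tridiagonal, and (2) there is a basis $\{v^*_i\}_{i=0}^d$ of $V$ in which $A^*$ is diagonal and $A$ is irreducible tridiagonal. Its diameter is $d=\dim V-1$. The Leonard pair is totally almost bipartite if the matrix of $A^*$ in (1) and the matrix of $A$ in (2) are both almost bipartite. Let $\theta_i$ be the eigenvalue of $A$ for $v_i$ and $\theta_i^*$ the eigenvalue of $A^*$ for $v_i^*$. It is known that the expressions $\frac{\theta_{i-2}-\theta_{i+1}}{\theta_{i-1}-\theta_i}$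 and $\frac{\theta^*_{i-2}-\theta^*_{i+1}}{\theta^*_{i-1}-\theta^*_i}$ are equal and independent of $i$ for $2\le i\le d-1$; the Leonard pair is of Bannai/Ito type if this common value is $-1$. Leonard pairs $A,A^*$ on $V$ and $B,B^*$ on $W$ are isomorphic if there is a vector space isomorphism $\phi:V\to W$ with $\phi A=B\phi$ and $\phi A^*=B^*\phi$. *)

theory Defs
  imports
    Complex_Main
    "HOL-Computational_Algebra.Polynomial"
    "HOL-Library.Function_Algebras"
    "Jordan_Normal_Form.Matrix"
begin

definition mat_trace :: "'a::comm_monoid_add mat \<Rightarrow> 'a" where
  "mat_trace B = (\<Sum>i<dim_row B. B $$ (i, i))"

definition tridiagonal_mat :: "'a::zero mat \<Rightarrow> bool" where
  "tridiagonal_mat B \<longleftrightarrow> square_mat B \<and>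
     (\<forall>i<dim_row B. \<forall>j<dim_row B.
        B $$ (i, j) \<noteq> 0 \<longrightarrow> i = j \<or> i = Suc j \<or> j = Suc i)"

definition irreducible_tridiagonal_mat :: "'a::zero mat \<Rightarrow> bool" where
  "irreducible_tridiagonal_mat B \<longleftrightarrow> tridiagonal_mat B \<and>
     (\<forall>i. Suc i < dim_row B \<longrightarrow> B $$ (Suc i, i) \<noteq> 0 \<and> B $$ (i, Suc i) \<noteq> 0)"

definition almost_bipartite_mat :: "'a::zero mat \<Rightarrow> bool" where
  "almost_bipartite_mat B \<longleftrightarrow> tridiagonal_mat B \<and>
     (let d = dim_row B - 1 in
        (B $$ (0, 0) \<noteq> 0) \<noteq> (B $$ (d, d) \<noteq> 0) \<and>
        (\<forall>i. 1 \<le> i \<and> i < d \<longrightarrow> B $$ (i, i) = 0))"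

text \<open>
  Vector spaces are subspaces of an ambient space satisfying
  \<^locale>\<open>vector_space\<close>. A linear map between subspaces is represented by a function
  on the ambient types whose values outside the domain are irrelevant.
\<close>

definition linear_between ::
  "('k \<Rightarrow> 'v \<Rightarrow> 'v) \<Rightarrow> ('k \<Rightarrow> 'w \<Rightarrow> 'w) \<Rightarrow>
   'v::ab_group_add set \<Rightarrow> 'w::ab_group_add set \<Rightarrow> ('v \<Rightarrow> 'w) \<Rightarrow> bool" where
  "linear_between s t V W f \<longleftrightarrow>
     (\<forall>x\<in>V. f x \<in> W) \<and>
     (\<forall>x\<in>V. \<forall>y\<in>V. f (x + y) = f x + f y) \<and>
     (\<forall>c. \<forall>x\<in>V. f (s c x) = t c (f x))"

text \<open>
  A separate locale, so that the definitions below are not also generated for the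
  existing instances of \<^locale>\<open>vector_space\<close> such as the real vector spaces.
\<close>

locale ambient_space = vector_space scale
  for scale :: "'a::field \<Rightarrow> 'b::ab_group_add \<Rightarrow> 'b"
begin

definition indexed_basis :: "'b set \<Rightarrow> (nat \<Rightarrow> 'b) \<Rightarrow> bool" where
  "indexed_basis V v \<longleftrightarrow>
     inj_on v {..<dim V} \<and> independent (v ` {..<dim V}) \<and> span (v ` {..<dim V}) = V"

text \<open>Column \<open>j\<close> holds the coordinates of \<open>A (v j)\<close>.\<close>

definition matrix_wrt :: "'b set \<Rightarrow> (nat \<Rightarrow> 'b) \<Rightarrow> ('b \<Rightarrow> 'b) \<Rightarrow> 'a mat" where
  "matrix_wrt V v A = mat (dim V) (dim V)
     (\<lambda>(i, j). representation (v ` {..<dim V}) (A (v j)) (v i))"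

text \<open>The choice of the basis does not affect the trace.\<close>

definition trace_on :: "'b set \<Rightarrow> ('b \<Rightarrow> 'b) \<Rightarrow> 'a" where
  "trace_on V A = mat_trace (matrix_wrt V (SOME v. indexed_basis V v) A)"

definition standard_basis :: "'b set \<Rightarrow> ('b \<Rightarrow> 'b) \<Rightarrow> ('b \<Rightarrow> 'b) \<Rightarrow> (nat \<Rightarrow> 'b) \<Rightarrow> bool" where
  "standard_basis V A As v \<longleftrightarrow> indexed_basis V v \<and>
     diagonal_mat (matrix_wrt V v A) \<and>
     irreducible_tridiagonal_mat (matrix_wrt V v As)"

text \<open>
  The library sets \<open>dim V = 0\<close> for infinite-dimensional \<open>V\<close>, so
  \<open>0 < dim V\<close> says that \<open>V\<close> has finite positive dimension.
\<close>

definition leonard_pair :: "'b set \<Rightarrow> ('b \<Rightarrow> 'b) \<Rightarrow> ('b \<Rightarrow> 'b) \<Rightarrow> bool" where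
  "leonard_pair V A As \<longleftrightarrow> subspace V \<and> 0 < dim V \<and>
     linear_between scale scale V V A \<and> linear_between scale scale V V As \<and>
     (\<exists>v. standard_basis V A As v) \<and>
     (\<exists>vs. standard_basis V As A vs)"

definition diameter :: "'b set \<Rightarrow> nat" where
  "diameter V = dim V - 1"

text \<open>
  The bases \<open>v\<close> and \<open>vs\<close> in the next two definitions are unique up to
  rescaling the basis vectors and reversing their order, neither of which affects the
  conditions imposed.
\<close>

definition totally_almost_bipartite :: "'b set \<Rightarrow> ('b \<Rightarrow> 'b) \<Rightarrow> ('b \<Rightarrow> 'b) \<Rightarrow> bool" where
  "totally_almost_bipartite V A As \<longleftrightarrow>
     (\<exists>v. standard_basis V A As v \<and> almost_bipartite_mat (matrix_wrt V v As)) \<and>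
     (\<exists>vs. standard_basis V As A vs \<and> almost_bipartite_mat (matrix_wrt V vs A))"

text \<open>
  The condition on \<open>i\<close> is \<open>2 \<le> i \<le> d - 1\<close>; it is vacuous for diameter \<open>d < 3\<close>,
  where the type is not defined.
\<close>

definition bannai_ito_type :: "'b set \<Rightarrow> ('b \<Rightarrow> 'b) \<Rightarrow> ('b \<Rightarrow> 'b) \<Rightarrow> bool" where
  "bannai_ito_type V A As \<longleftrightarrow>
     (\<exists>v vs \<theta> \<theta>s.
        standard_basis V A As v \<and> (\<forall>i\<le>diameter V. A (v i) = scale (\<theta> i) (v i)) \<and>
        standard_basis V As A vs \<and> (\<forall>i\<le>diameter V. As (vs i) = scale (\<theta>s i) (vs i)) \<and>
        (\<forall>i. 2 \<le> i \<and> i < diameter V \<longrightarrow>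
           (\<theta> (i - 2) - \<theta> (i + 1)) / (\<theta> (i - 1) - \<theta> i) = - 1 \<and>
           (\<theta>s (i - 2) - \<theta>s (i + 1)) / (\<theta>s (i - 1) - \<theta>s i) = - 1))"

definition tab_bi_leonard_pair ::
  "nat \<Rightarrow> 'a \<Rightarrow> 'a \<Rightarrow> 'b set \<Rightarrow> ('b \<Rightarrow> 'b) \<Rightarrow> ('b \<Rightarrow> 'b) \<Rightarrow> bool" where
  "tab_bi_leonard_pair d \<tau> \<tau>s V A As \<longleftrightarrow>
     leonard_pair V A As \<and> totally_almost_bipartite V A As \<and> bannai_ito_type V A As \<and>
     diameter V = d \<and> trace_on V A = \<tau> \<and> trace_on V As = \<tau>s"

end

definition leonard_pairs_isomorphic ::
  "('k \<Rightarrow> 'v \<Rightarrow> 'v) \<Rightarrow> ('k \<Rightarrow> 'w \<Rightarrow> 'w) \<Rightarrow>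
   'v::ab_group_add set \<Rightarrow> ('v \<Rightarrow> 'v) \<Rightarrow> ('v \<Rightarrow> 'v) \<Rightarrow>
   'w::ab_group_add set \<Rightarrow> ('w \<Rightarrow> 'w) \<Rightarrow> ('w \<Rightarrow> 'w) \<Rightarrow> bool" where
  "leonard_pairs_isomorphic s t V A As W B Bs \<longleftrightarrow>
     (\<exists>\<phi>. linear_between s t V W \<phi> \<and> bij_betw \<phi> V W \<and>
        (\<forall>x\<in>V. \<phi> (A x) = B (\<phi> x)) \<and> (\<forall>x\<in>V. \<phi> (As x) = Bs (\<phi> x)))"

text \<open>
  HOL cannot quantify existentially over types. Existence of a vector space is therefore
  stated in the ambient space of sequences, which contains an isomorphic copy of every
  finite-dimensional space.
\<close>

definition seq_scale :: "'k::field \<Rightarrow> (nat \<Rightarrow> 'k) \<Rightarrow> (nat \<Rightarrow> 'k)" where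
  "seq_scale c x = (\<lambda>n. c * x n)"

lemma vector_space_seq_scale: "vector_space seq_scale"
  by unfold_locales (auto simp: seq_scale_def fun_eq_iff algebra_simps)

end

(*
  In the eigenbasis of As, let T be the matrix of A, and let \<theta> i be the eigenvalues of A.  By the
  Bannai/Ito condition \<theta> i + \<theta> (i + 1) takes only two values p and q, and since As is almost
  bipartite in the eigenbasis of A, the operator
    A^2 As + 2 A As A + As A^2 - (p + q) (A As + As A) + p q As
  is diagonal there with at most one nonzero entry, at an end.  Its matrix in the eigenbasis of As
  is pentadiagonal, so for d >= 3 it vanishes.  Its (0, 2) entry then gives p* + q* = 0, dually
  p + q = 0, the vanishing end entry fixes \<theta> up to a scalar, which the trace determines, and the
  diagonal entries give a recurrence for T i (i + 1) * T (i + 1) i.  The only solution is a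
  multiple of the folded cube of odd order 2 d + 1, whose character table (signed Krawtchouk
  polynomials) shows that it is self-dual.
*)

theory Submission
  imports Defs
begin

subsection \<open>Tridiagonal relations for Bannai/Ito systems\<close>


text \<open>In the eigenbasis of \<open>A\<close> the operator has the entries \<open>Ts m j\<close>
  (x - p) (x - q) with x = \<theta> m + \<theta> j, because its weights 1, 2, 1 complete a square.
  Neighbouring positions vanish by the choice of p and q, diagonal ones because \<open>Ts\<close>
  has only one nonzero diagonal entry. The vanishing end entry, together with \<theta> (d - 1)
  \<noteq> \<theta> d, says that the alternation of the consecutive sums continues when the path is
  prolonged by \<theta> (d + 1) = \<theta> d. A path 0, ..., 2 d + 1 folded at its middle is thus
  where the cube of dimension 2 d + 1 comes from. An obstacle lies in the definitions: the almost
  bipartite and the Bannai/Ito condition choose their eigenbases independently. Eigenspaces are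
  lines, and the tridiagonal shape arranges them in a path, so the order is unique up to reversal
  and one basis can serve both conditions.\<close>

lemma sum_tridiagonal:
  fixes g :: "nat \<Rightarrow> 'a::comm_monoid_add"
  assumes "i \<le> d" and "\<And>k. k \<le> d \<Longrightarrow> \<not> (i = k \<or> i = Suc k \<or> k = Suc i) \<Longrightarrow> g k = 0"
  shows "(\<Sum>k\<le>d. g k) =
    (if i = 0 then 0 else g (i - 1)) + g i + (if i = d then 0 else g (Suc i))"
proof -
  let ?S = "(if i = 0 then {} else {i - 1}) \<union> {i} \<union> (if i = d then {} else {Suc i})"
  have "(\<Sum>k\<le>d. g k) = sum g ?S"
    by (rule sum.mono_neutral_right; use assms in \<open>cases i\<close>) (auto split: if_splits)
  also have "\<dots> = (if i = 0 then 0 else g (i - 1)) + g i + (if i = d then 0 else g (Suc i))"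
    by (cases i) (auto simp: insert_commute add_ac)
  finally show ?thesis .
qed

text \<open>Row \<open>j\<close> of the eigenvalue equation expresses
  \<open>T j (Suc j) * f (Suc j)\<close> by \<open>f j\<close> and \<open>f (j - 1)\<close>, so
  \<open>f 0\<close> determines all of \<open>f\<close>. This is why eigenspaces of irreducible
  tridiagonal matrices are lines.\<close>

lemma tridiagonal_eigenvector_eq_0:
  fixes T :: "nat \<Rightarrow> nat \<Rightarrow> 'a::field"
  assumes tri: "\<And>i k. i \<le> d \<Longrightarrow> k \<le> d \<Longrightarrow> \<not> (i = k \<or> i = Suc k \<or> k = Suc i) \<Longrightarrow> T i k = 0"
    and irr: "\<And>i. i < d \<Longrightarrow> T i (Suc i) \<noteq> 0"
    and f: "\<And>i. i \<le> d \<Longrightarrow> (\<Sum>k\<le>d. T i k * f k) = c * f i" and "f 0 = 0" and "i \<le> d"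
  shows "f i = 0"
  using \<open>i \<le> d\<close>
proof (induction i rule: less_induct)
  case (less i)
  show ?case
  proof (cases i)
    case (Suc j)
    have "(\<Sum>k\<le>d. T j k * f k)
        = (if j = 0 then 0 else T j (j - 1) * f (j - 1)) + T j j * f j + T j (Suc j) * f (Suc j)"
      using less.prems Suc by (subst sum_tridiagonal[of j]) (auto simp: tri)
    moreover have "f j = 0" "f (j - 1) = 0"
      using less Suc by auto
    ultimately have "T j (Suc j) * f (Suc j) = 0"
      using f[of j] Suc less.prems by (auto split: if_splits)
    then show ?thesis using irr[of j] Suc less.prems by auto
  qed (use \<open>f 0 = 0\<close> in simp)
qed

text \<open>The trace of the folded cube: the terms are its eigenvalues, and d + 1 is its only
  nonzero diagonal entry.\<close>

lemma sum_alternating_odd: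
  "(\<Sum>i\<le>d. (-1) ^ i * (2 * of_nat d + 1 - 2 * of_nat i)) = (of_nat d + 1 :: 'a::comm_ring_1)"
proof (induction d)
  case (Suc d)
  have *: "(\<Sum>i\<le>n. (-1) ^ i * 2 :: 'a) = 1 + (-1) ^ n" for n
    by (induction n) auto
  have "(\<Sum>i\<le>Suc d. (-1) ^ i * (2 * of_nat (Suc d) + 1 - 2 * of_nat i) :: 'a)
      = (\<Sum>i\<le>d. (-1) ^ i * (2 * of_nat d + 1 - 2 * of_nat i) + (-1) ^ i * 2) + (-1) ^ Suc d"
    by (simp add: algebra_simps)
  also have "\<dots> = of_nat d + 1 + (\<Sum>i\<le>d. (-1) ^ i * 2) + (-1) ^ Suc d"
    by (simp only: sum.distrib Suc.IH)
  finally show ?case by (simp add: *)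
qed auto

text \<open>
  \<open>T\<close> is the matrix of \<open>A\<close> in the eigenbasis of \<open>As\<close>, \<open>Ts\<close> is the matrix of \<open>As\<close> in the eigenbasis
  of \<open>A\<close>, and column \<open>j\<close> of \<open>X\<close> holds the coordinates of the \<open>j\<close>-th eigenvector of \<open>A\<close>. Transposing
  \<open>X\<close> exchanges the roles of \<open>A\<close> and \<open>As\<close>.
\<close>

locale bannai_ito_system =
  fixes d :: nat and T Ts X :: "nat \<Rightarrow> nat \<Rightarrow> 'k::field_char_0" and \<theta> \<theta>s :: "nat \<Rightarrow> 'k"
  assumes d_ge: "3 \<le> d"
    and T_tri: "i \<le> d \<Longrightarrow> k \<le> d \<Longrightarrow> \<not> (i = k \<or> i = Suc k \<or> k = Suc i) \<Longrightarrow> T i k = 0"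
    and T_irr: "i < d \<Longrightarrow> T i (Suc i) \<noteq> 0" "i < d \<Longrightarrow> T (Suc i) i \<noteq> 0"
    and T_diag: "i < d \<Longrightarrow> T i i = 0" "T d d \<noteq> 0"
    and Ts_tri: "i \<le> d \<Longrightarrow> k \<le> d \<Longrightarrow> \<not> (i = k \<or> i = Suc k \<or> k = Suc i) \<Longrightarrow> Ts i k = 0"
    and Ts_irr: "i < d \<Longrightarrow> Ts i (Suc i) \<noteq> 0" "i < d \<Longrightarrow> Ts (Suc i) i \<noteq> 0"
    and Ts_diag: "i < d \<Longrightarrow> Ts i i = 0" "Ts d d \<noteq> 0"
    and TX: "i \<le> d \<Longrightarrow> j \<le> d \<Longrightarrow> (\<Sum>k\<le>d. T i k * X k j) = \<theta> j * X i j"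
    and XTs: "i \<le> d \<Longrightarrow> j \<le> d \<Longrightarrow> (\<Sum>k\<le>d. X i k * Ts k j) = \<theta>s i * X i j"
    and row_indep: "(\<And>j. j \<le> d \<Longrightarrow> (\<Sum>k\<le>d. f k * X k j) = 0) \<Longrightarrow> k \<le> d \<Longrightarrow> f k = 0"
    and col_indep: "(\<And>i. i \<le> d \<Longrightarrow> (\<Sum>k\<le>d. X i k * f k) = 0) \<Longrightarrow> k \<le> d \<Longrightarrow> f k = 0"
    and bi: "i + 3 \<le> d \<Longrightarrow> \<theta> i + \<theta> (i + 1) = \<theta> (i + 2) + \<theta> (i + 3)"
    and bis: "i + 3 \<le> d \<Longrightarrow> \<theta>s i + \<theta>s (i + 1) = \<theta>s (i + 2) + \<theta>s (i + 3)"
    and trace: "(\<Sum>i\<le>d. \<theta> i) = T d d" "(\<Sum>i\<le>d. \<theta>s i) = Ts d d"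
begin

lemma dual:
  "bannai_ito_system d (\<lambda>i k. Ts k i) (\<lambda>k j. T j k) (\<lambda>i j. X j i) \<theta>s \<theta>"
proof (unfold_locales, goal_cases)
  case (12 i j)
  then show ?case using XTs[of j i] by (simp add: mult.commute)
next
  case (13 i j)
  then show ?case using TX[of j i] by (simp add: mult.commute)
next
  case (14 f k)
  then show ?case using col_indep[of f k] by (simp add: mult.commute)
next
  case (15 f k)
  then show ?case using row_indep[of f k] by (simp add: mult.commute)
next
  case (2 i k) then show ?case using Ts_tri[of k i] by auto
next
  case (7 i k) then show ?case using T_tri[of k i] by auto
qed (use d_ge T_irr Ts_irr T_diag Ts_diag bi bis trace in auto)

lemma eigenvector_eq_0:
  assumes "\<And>i. i \<le> d \<Longrightarrow> (\<Sum>k\<le>d. T i k * f k) = c * f i" "f 0 = 0" "i \<le> d"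
  shows "f i = 0"
  by (rule tridiagonal_eigenvector_eq_0[of d T f c]) (use T_tri T_irr assms in auto)

text \<open>An eigenvector of \<open>T\<close> with entry 0 at index 0 vanishes, but no column of
  \<open>X\<close> can.\<close>

lemma X_0_neq_0:
  assumes "j \<le> d" shows "X 0 j \<noteq> 0"
proof
  assume "X 0 j = 0"
  have "X i j = 0" if "i \<le> d" for i
    by (rule eigenvector_eq_0[of "\<lambda>i. X i j" "\<theta> j", OF TX[OF _ assms] \<open>X 0 j = 0\<close> that])
  then have "(\<Sum>k\<le>d. X i k * (if k = j then 1 else 0)) = 0" if "i \<le> d" for i
    using that by (intro sum.neutral) auto
  from col_indep[OF this assms] show False by simp
qed

text \<open>If two eigenvalues agree, the combination \<open>?f\<close> of the two columns of
  \<open>X\<close> is an eigenvector whose entry at 0 cancels. It is therefore zero, against the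
  independence of the columns; \<open>?g\<close> lists its coefficients.\<close>

lemma \<theta>_neq:
  assumes "i \<le> d" "j \<le> d" "i \<noteq> j" shows "\<theta> i \<noteq> \<theta> j"
proof
  assume eq: "\<theta> i = \<theta> j"
  let ?f = "\<lambda>k. X 0 j * X k i - X 0 i * X k j"
  have "(\<Sum>k\<le>d. T m k * ?f k) = \<theta> i * ?f m" if "m \<le> d" for m
  proof -
    have "(\<Sum>k\<le>d. T m k * ?f k)
        = X 0 j * (\<Sum>k\<le>d. T m k * X k i) - X 0 i * (\<Sum>k\<le>d. T m k * X k j)"
      by (simp add: sum_distrib_left sum_subtractf[symmetric] algebra_simps)
    then show ?thesis
      using TX[OF that assms(1)] TX[OF that assms(2)] eq by (simp add: algebra_simps)
  qed
  then have f0: "?f m = 0" if "m \<le> d" for m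
    using eigenvector_eq_0[of ?f "\<theta> i" m] that by auto
  let ?g = "\<lambda>k. (if k = i then X 0 j else 0) - (if k = j then X 0 i else 0)"
  have "(\<Sum>k\<le>d. X m k * ?g k) = 0" if "m \<le> d" for m
  proof -
    have "(\<Sum>k\<le>d. X m k * ?g k)
        = (\<Sum>k\<le>d. (if k = i then X m k * X 0 j else 0) - (if k = j then X m k * X 0 i else 0))"
      by (intro sum.cong) auto
    also have "\<dots> = ?f m"
      using assms by (simp add: sum_subtractf mult.commute)
    finally show ?thesis using f0[OF that] by simp
  qed
  from col_indep[OF this assms(1)] X_0_neq_0[OF assms(2)] assms show False by simp
qed

text \<open>
  The matrix of \<open>A\<^sup>2 As + 2 A As A + As A\<^sup>2 - \<gamma> (A As + As A) - \<rho> As\<close> in the eigenbasis of \<open>As\<close>.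
\<close>

definition C :: "'k \<Rightarrow> 'k \<Rightarrow> nat \<Rightarrow> nat \<Rightarrow> 'k" where
  "C \<gamma> \<rho> i k = (\<Sum>l\<le>d. T i l * T l k * (\<theta>s i + 2 * \<theta>s l + \<theta>s k))
     - \<gamma> * T i k * (\<theta>s i + \<theta>s k) - (if i = k then \<rho> * \<theta>s i else 0)"

text \<open>With D = diag(\<theta>s) and E = diag(\<theta>), the locale says T X = X E and D X = X
  Ts. Moving \<open>X\<close> to the left turns the words T^2 D, T D T, D T^2 into E^2 Ts, E Ts E,
  Ts E^2. Their (m, j) entries are \<open>Ts m j\<close> times a quadratic monomial in \<theta> m
  and \<theta> j, and the weights 1, 2, 1 give the square of \<theta> m + \<theta> j.\<close>

lemma C_mult_X:
  assumes ij: "i \<le> d" "j \<le> d"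
  shows "(\<Sum>k\<le>d. C \<gamma> \<rho> i k * X k j) =
    (\<Sum>m\<le>d. X i m * Ts m j * ((\<theta> m + \<theta> j)\<^sup>2 - \<gamma> * (\<theta> m + \<theta> j) - \<rho>))"
proof -
  \<comment> \<open>In matrix form \<open>1\<close> is T D X = X E Ts, and \<open>2\<close> below is
    T^2 D X = X E^2 Ts.\<close>
  have 1: "(\<Sum>k\<le>d. T l k * (\<theta>s k * X k j)) = (\<Sum>m\<le>d. \<theta> m * X l m * Ts m j)" if "l \<le> d" for l
  proof -
    have "(\<Sum>k\<le>d. T l k * (\<theta>s k * X k j)) = (\<Sum>k\<le>d. \<Sum>m\<le>d. T l k * X k m * Ts m j)"
      using ij by (intro sum.cong) (simp_all flip: XTs add: sum_distrib_left mult.assoc)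
    also have "\<dots> = (\<Sum>m\<le>d. (\<Sum>k\<le>d. T l k * X k m) * Ts m j)"
      by (subst sum.swap) (simp add: sum_distrib_right)
    finally show ?thesis using TX[OF that] by simp
  qed
  have 2: "(\<Sum>l\<le>d. T i l * (\<Sum>k\<le>d. T l k * (\<theta>s k * X k j))) = (\<Sum>m\<le>d. (\<theta> m)\<^sup>2 * X i m * Ts m j)"
  proof -
    have "(\<Sum>l\<le>d. T i l * (\<Sum>k\<le>d. T l k * (\<theta>s k * X k j)))
        = (\<Sum>l\<le>d. \<Sum>m\<le>d. \<theta> m * (T i l * X l m) * Ts m j)"
      by (intro sum.cong refl, subst 1) (simp_all add: sum_distrib_left mult_ac)
    also have "\<dots> = (\<Sum>m\<le>d. \<theta> m * (\<Sum>l\<le>d. T i l * X l m) * Ts m j)"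
      by (subst sum.swap) (simp add: sum_distrib_left sum_distrib_right)
    finally show ?thesis using TX[OF ij(1)] by (simp add: power2_eq_square mult_ac)
  qed
  have 3: "(\<Sum>k\<le>d. T l k * X k j) = \<theta> j * X l j" if "l \<le> d" for l
    using TX that ij by simp
  have "(\<Sum>k\<le>d. C \<gamma> \<rho> i k * X k j)
      = (\<Sum>k\<le>d. \<Sum>l\<le>d. T i l * T l k * (\<theta>s i + 2 * \<theta>s l + \<theta>s k) * X k j)
        - \<gamma> * (\<Sum>k\<le>d. T i k * (\<theta>s i + \<theta>s k) * X k j) - \<rho> * \<theta>s i * X i j"
    using ij by (simp add: C_def left_diff_distrib sum_subtractf sum_distrib_left sum_distrib_right
        mult.assoc if_distrib[of "\<lambda>x. x * _"] cong: if_cong)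
  also have "(\<Sum>k\<le>d. T i k * (\<theta>s i + \<theta>s k) * X k j)
      = \<theta>s i * (\<Sum>k\<le>d. T i k * X k j) + (\<Sum>k\<le>d. T i k * (\<theta>s k * X k j))"
    by (simp add: algebra_simps sum.distrib sum_distrib_left)
  also have "(\<Sum>k\<le>d. \<Sum>l\<le>d. T i l * T l k * (\<theta>s i + 2 * \<theta>s l + \<theta>s k) * X k j)
      = (\<Sum>l\<le>d. \<Sum>k\<le>d. \<theta>s i * (T i l * (T l k * X k j)) + 2 * (T i l * (\<theta>s l * (T l k * X k j)))
          + T i l * (T l k * (\<theta>s k * X k j)))"
    by (subst sum.swap) (simp add: algebra_simps)
  also have "\<dots> = \<theta>s i * (\<Sum>l\<le>d. T i l * (\<Sum>k\<le>d. T l k * X k j))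
      + 2 * (\<Sum>l\<le>d. T i l * (\<theta>s l * (\<Sum>k\<le>d. T l k * X k j)))
      + (\<Sum>l\<le>d. T i l * (\<Sum>k\<le>d. T l k * (\<theta>s k * X k j)))"
    by (simp only: sum.distrib sum_distrib_left)
  also have "(\<Sum>l\<le>d. T i l * (\<Sum>k\<le>d. T l k * X k j)) = \<theta> j * (\<theta> j * X i j)"
  proof -
    have "(\<Sum>l\<le>d. T i l * (\<Sum>k\<le>d. T l k * X k j)) = (\<Sum>l\<le>d. \<theta> j * (T i l * X l j))"
      by (intro sum.cong refl, subst 3) auto
    then show ?thesis using 3[OF ij(1)] by (simp only: sum_distrib_left[symmetric])
  qed
  also have "(\<Sum>l\<le>d. T i l * (\<theta>s l * (\<Sum>k\<le>d. T l k * X k j)))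
      = \<theta> j * (\<Sum>k\<le>d. T i k * (\<theta>s k * X k j))"
    unfolding sum_distrib_left[of "\<theta> j"] by (intro sum.cong refl, subst 3) auto
  also have "(\<Sum>k\<le>d. T i k * X k j) = \<theta> j * X i j"
    using 3 ij by simp
  also have "(\<Sum>k\<le>d. T i k * (\<theta>s k * X k j)) = (\<Sum>m\<le>d. \<theta> m * X i m * Ts m j)"
    using 1 ij by simp
  also note 2
  finally have "(\<Sum>k\<le>d. C \<gamma> \<rho> i k * X k j)
      = ((\<theta> j)\<^sup>2 - \<gamma> * \<theta> j - \<rho>) * (\<theta>s i * X i j) + (2 * \<theta> j - \<gamma>) * (\<Sum>m\<le>d. \<theta> m * X i m * Ts m j)
        + (\<Sum>m\<le>d. (\<theta> m)\<^sup>2 * X i m * Ts m j)"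
    by (simp add: algebra_simps power2_eq_square)
  also have "\<theta>s i * X i j = (\<Sum>k\<le>d. X i k * Ts k j)"
    using XTs ij by simp
  finally show ?thesis
    by (simp add: algebra_simps sum.distrib sum_subtractf sum_distrib_left power2_eq_square)
qed

abbreviation "\<theta>p \<equiv> \<theta> 0 + \<theta> 1"
abbreviation "\<theta>q \<equiv> \<theta> 1 + \<theta> 2"

lemma \<theta>_sum_cases:
  "i < d \<Longrightarrow> \<theta> i + \<theta> (Suc i) = (if even i then \<theta>p else \<theta>q)"
proof (induction i rule: less_induct)
  case (less i)
  consider "i = 0" | "i = 1" | k where "i = k + 2"
    by (metis add_2_eq_Suc' not0_implies_Suc One_nat_def)
  then show ?case
  proof cases
    case 3
    then have "\<theta> i + \<theta> (Suc i) = \<theta> k + \<theta> (Suc k)"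
      using bi[of k] less.prems by (simp add: numeral_3_eq_3)
    then show ?thesis using 3 less by simp
  qed (auto simp: numeral_2_eq_2)
qed

lemma quadratic_vanishes:
  assumes "m \<le> d" "j \<le> d" "m = Suc j \<or> j = Suc m"
  shows "(\<theta> m + \<theta> j)\<^sup>2 - (\<theta>p + \<theta>q) * (\<theta> m + \<theta> j) + \<theta>p * \<theta>q = 0"
proof -
  have "\<theta> m + \<theta> j = \<theta>p \<or> \<theta> m + \<theta> j = \<theta>q"
    using assms \<theta>_sum_cases[of m] \<theta>_sum_cases[of j] by (auto simp: add.commute split: if_splits)
  then have "(\<theta> m + \<theta> j - \<theta>p) * (\<theta> m + \<theta> j - \<theta>q) = 0" by auto
  then show ?thesis by (simp add: algebra_simps power2_eq_square)
qed

text \<open>These constants turn the last factor in \<open>C_mult_X\<close> into (x - \<theta>p) (x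
  - \<theta>q) at x = \<theta> m + \<theta> j.\<close>

abbreviation "C0 \<equiv> C (\<theta>p + \<theta>q) (- (\<theta>p * \<theta>q))"

text \<open>For m \<noteq> j each summand of \<open>C_mult_X\<close> is killed by tridiagonality or
  by \<open>quadratic_vanishes\<close>; for m = j it contains \<open>Ts j j\<close>, which is zero
  unless j = d.\<close>

lemma C0_mult_X:
  assumes "i \<le> d" "j \<le> d"
  shows "(\<Sum>k\<le>d. C0 i k * X k j) =
    (if j = d then Ts d d * (2 * \<theta> d - \<theta>p) * (2 * \<theta> d - \<theta>q) * X i d else 0)"
proof -
  let ?Q = "\<lambda>m. X i m * Ts m j * ((\<theta> m + \<theta> j)\<^sup>2 - (\<theta>p + \<theta>q) * (\<theta> m + \<theta> j) - - (\<theta>p * \<theta>q))"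
  have "?Q m = 0" if "m \<le> d" "m \<noteq> j" for m
    using that assms quadratic_vanishes[of m j] Ts_tri[of m j] by auto
  then have "(\<Sum>m\<le>d. ?Q m) = ?Q j"
    using assms by (subst sum.mono_neutral_right[of _ "{j}"]) auto
  then show ?thesis
    using assms Ts_diag(1)[of j] unfolding C_mult_X[OF assms]
    by (auto simp: algebra_simps power2_eq_square)
qed

lemma C_far:
  assumes "i \<le> d" "k \<le> d" "i + 2 < k \<or> k + 2 < i"
  shows "C \<gamma> \<rho> i k = 0"
proof -
  have "T i l * T l k = 0" if "l \<le> d" for l
    using assms that T_tri[of i l] T_tri[of l k] by fastforce
  then have "(\<Sum>l\<le>d. T i l * T l k * (\<theta>s i + 2 * \<theta>s l + \<theta>s k)) = 0"
    by (intro sum.neutral) auto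
  then show ?thesis using assms T_tri[of i k] by (auto simp: C_def)
qed

text \<open>
  Row \<open>0\<close> of \<open>C0\<close> has at most three nonzero entries, so that row of \<open>C0 X\<close> is a
  combination of three eigenvectors of \<open>Ts\<close>, hence killed by a cubic in \<open>Ts\<close>.
  But it is supported on position \<open>d\<close>, and \<open>Ts ^ 3\<close> carries it to position \<open>d - 3\<close>.
\<close>

lemma corner_vanishes: "Ts d d * (2 * \<theta> d - \<theta>p) * (2 * \<theta> d - \<theta>q) = 0"
proof -
  define c where "c = C0 0"
  \<comment> \<open>\<open>M m\<close> is the row c D^m X with D = diag(\<theta>s), which equals c X
    Ts^m.\<close>
  define M where "M m j = (\<Sum>k\<le>d. c k * \<theta>s k ^ m * X k j)" for m j
  have step: "M (Suc m) j = (\<Sum>l\<le>d. M m l * Ts l j)" if "j \<le> d" for m j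
  proof -
    have "M (Suc m) j = (\<Sum>k\<le>d. \<Sum>l\<le>d. c k * \<theta>s k ^ m * (X k l * Ts l j))"
      unfolding M_def using that XTs
      by (intro sum.cong) (simp_all flip: sum_distrib_left)
    then show ?thesis
      unfolding M_def by (subst (asm) sum.swap) (simp add: sum_distrib_right mult.assoc)
  qed
  have M0: "M 0 j = 0" if "j < d" for j
    using C0_mult_X[of 0 j] that by (simp add: M_def c_def)
  \<comment> \<open>One multiplication by \<open>Ts\<close> moves the left end of the support by at
    most one position; \<open>lead\<close> computes the entry at that end.\<close>
  have vanish: "M m j = 0" if "j + m < d" for m j
    using that
  proof (induction m arbitrary: j)
    case (Suc m)
    have "M (Suc m) j = (\<Sum>l\<le>d. M m l * Ts l j)" using step Suc.prems by simp
    also have "\<dots> = 0"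
    proof (rule sum.neutral, intro ballI)
      fix l assume "l \<in> {..d}"
      then show "M m l * Ts l j = 0"
        using Suc.IH[of l] Suc.prems Ts_tri[of l j] by (cases "l + m < d") auto
    qed
    finally show ?case .
  qed (use M0 in simp)
  have lead: "M (Suc m) j = M m (Suc j) * Ts (Suc j) j" if "Suc (j + m) = d" for m j
  proof -
    have "M (Suc m) j = (\<Sum>l\<le>d. M m l * Ts l j)" using step that by simp
    also have "\<dots> = (if j = 0 then 0 else M m (j - 1) * Ts (j - 1) j) + M m j * Ts j j
        + (if j = d then 0 else M m (Suc j) * Ts (Suc j) j)"
      by (rule sum_tridiagonal) (use that in \<open>auto intro: Ts_tri\<close>)
    finally show ?thesis using that vanish[of "j - 1" m] vanish[of j m] by auto
  qed
  have M_three: "M m j = c 0 * \<theta>s 0 ^ m * X 0 j + c 1 * \<theta>s 1 ^ m * X 1 j + c 2 * \<theta>s 2 ^ m * X 2 j"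
    for m j
  proof -
    have "M m j = (\<Sum>k\<le>2. c k * \<theta>s k ^ m * X k j)"
      unfolding M_def c_def using d_ge by (intro sum.mono_neutral_right) (auto simp: C_far)
    then show ?thesis by (simp add: numeral_2_eq_2)
  qed
  \<comment> \<open>Powers of \<theta>s 0, \<theta>s 1 and \<theta>s 2 satisfy the recurrence of the
    cubic with these three roots, hence so does \<open>M m j\<close>. At j = d - 3 the right-hand
    side vanishes, while \<open>M 3 j\<close> is a nonzero multiple of \<open>M 0 d\<close>.\<close>
  have "M 3 j = (\<theta>s 0 + \<theta>s 1 + \<theta>s 2) * M 2 j
      - (\<theta>s 0 * \<theta>s 1 + \<theta>s 0 * \<theta>s 2 + \<theta>s 1 * \<theta>s 2) * M 1 j + \<theta>s 0 * \<theta>s 1 * \<theta>s 2 * M 0 j" for j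
    unfolding M_three by (simp add: algebra_simps power2_eq_square power3_eq_cube)
  moreover obtain n where n: "d = Suc (Suc (Suc n))"
    using d_ge by (metis Suc_le_D numeral_3_eq_3 Suc_le_mono)
  ultimately have "M (Suc (Suc (Suc 0))) n = 0"
    using vanish[of n 0] vanish[of n 1] vanish[of n 2] by (simp add: numeral_3_eq_3)
  moreover have "M (Suc (Suc (Suc 0))) n
      = M 0 d * Ts d (Suc (Suc n)) * Ts (Suc (Suc n)) (Suc n) * Ts (Suc n) n"
    using lead[of n "Suc (Suc 0)"] lead[of "Suc n" "Suc 0"] lead[of "Suc (Suc n)" 0] n by simp
  ultimately have "M 0 d = 0"
    using Ts_irr(2)[of "Suc (Suc n)"] Ts_irr(2)[of "Suc n"] Ts_irr(2)[of n] n by simp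
  then show ?thesis
    using C0_mult_X[of 0 d] X_0_neq_0[of d] by (simp add: M_def c_def)
qed

lemma C0_eq_0:
  assumes "i \<le> d" "k \<le> d" shows "C0 i k = 0"
proof (rule row_indep[of "C0 i"])
  show "(\<Sum>k\<le>d. C0 i k * X k j) = 0" if "j \<le> d" for j
    using C0_mult_X[OF assms(1) that] corner_vanishes by simp
qed fact

section \<open>The eigenvalues of \<open>A\<close> and \<open>As\<close>\<close>

lemma dual_p_plus_q: "\<theta>s 0 + 2 * \<theta>s 1 + \<theta>s 2 = 0"
proof -
  have "C0 0 2 = T 0 1 * T 1 2 * (\<theta>s 0 + 2 * \<theta>s 1 + \<theta>s 2)"
    using d_ge T_tri[of 0 2] unfolding C_def
    by (subst sum_tridiagonal[of 0]) (auto simp: T_tri)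
  then show ?thesis
    using C0_eq_0[of 0 2] d_ge T_irr(1)[of 0] T_irr(1)[of 1] by (simp add: numeral_2_eq_2)
qed

lemma p_plus_q: "\<theta>p + \<theta>q = 0"
proof -
  interpret dual: bannai_ito_system d "\<lambda>i k. Ts k i" "\<lambda>k j. T j k" "\<lambda>i j. X j i" \<theta>s \<theta>
    by (rule dual)
  show ?thesis using dual.dual_p_plus_q by (simp add: algebra_simps)
qed

lemma \<theta>_formula_aux:
  assumes "i \<le> d" shows "\<theta> i = (-1) ^ i * (\<theta> 0 - \<theta>p * of_nat i)"
  using assms
proof (induction i)
  case (Suc i)
  have "\<theta>q = - \<theta>p" using p_plus_q by (metis add_eq_0_iff)
  then have "\<theta> i + \<theta> (Suc i) = (-1) ^ i * \<theta>p"
    using \<theta>_sum_cases[of i] Suc.prems by auto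
  then have "\<theta> (Suc i) = (-1) ^ i * \<theta>p - \<theta> i" by (simp add: algebra_simps)
  then show ?case using Suc by (simp add: algebra_simps)
qed simp

text \<open>The vanishing corner leaves two values for \<open>\<theta> d\<close>, and distinctness
  of the eigenvalues settles the sign. Then 2 \<theta> d = (-1)^d p fixes \<theta> 0 through
  \<open>\<theta>_formula_aux\<close>.\<close>

lemma \<theta>_formula_p:
  assumes "i \<le> d"
  shows "\<theta> i = \<theta>p / 2 * ((-1) ^ i * (2 * of_nat d + 1 - 2 * of_nat i))"
proof -
  have q: "\<theta>q = - \<theta>p" using p_plus_q by (metis add_eq_0_iff)
  define p where "p = \<theta>p"
  have "(2 * \<theta> d - \<theta>p) * (2 * \<theta> d - \<theta>q) = 0"
    using corner_vanishes Ts_diag(2) by (metis mult.assoc mult_eq_0_iff)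
  then have "2 * \<theta> d = p \<or> 2 * \<theta> d = - p"
    unfolding q p_def by (simp add: eq_neg_iff_add_eq_0)
  \<comment> \<open>With this sign 2 \<theta> d would equal the consecutive sum \<theta> (d - 1) +
    \<theta> d.\<close>
  moreover have "2 * \<theta> d \<noteq> - ((-1) ^ d * p)"
  proof
    assume *: "2 * \<theta> d = - ((-1) ^ d * p)"
    obtain n where n: "d = Suc n" using d_ge by (cases d) auto
    have "\<theta> n + \<theta> d = (if even n then p else - p)"
      using \<theta>_sum_cases[of n] n unfolding q p_def by (simp only: lessI)
    then have "\<theta> (d - 1) + \<theta> d = - ((-1) ^ d * p)"
      using n by simp
    then have "\<theta> (d - 1) = \<theta> d" unfolding *[symmetric] mult_2 by (simp only: add_right_cancel)
    then show False using \<theta>_neq[of n d] n by simp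
  qed
  ultimately have "2 * \<theta> d = (-1) ^ d * p"
    by (cases "even d") auto
  moreover have "\<theta> d = (-1) ^ d * (\<theta> 0 - p * of_nat d)"
    unfolding p_def by (rule \<theta>_formula_aux) simp
  ultimately have "(-1) ^ d * (2 * (\<theta> 0 - p * of_nat d)) = (-1) ^ d * p"
    by (simp only: mult.left_commute)
  then have "2 * (\<theta> 0 - p * of_nat d) = p"
    by (simp only: mult_cancel_left power_eq_0_iff neg_equal_0_iff_equal zero_neq_one simp_thms)
      simp
  moreover have "a = p / 2 * (2 * n + 1)" if "2 * (a - p * n) = p" for a n :: 'k
    using that by (simp add: field_simps)
  ultimately have \<theta>_0: "\<theta> 0 = p / 2 * (2 * of_nat d + 1)" by blast
  have "\<theta> i = (-1) ^ i * (\<theta> 0 - p * of_nat i)"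
    using \<theta>_formula_aux[OF assms] unfolding p_def .
  also have "\<dots> = p / 2 * ((-1) ^ i * (2 * of_nat d + 1 - 2 * of_nat i))"
  proof -
    have "(-1) ^ i * (h * (2 * of_nat d + 1) - 2 * h * of_nat i)
        = h * ((-1) ^ i * (2 * of_nat d + 1 - 2 * of_nat i))" for h :: 'k
      by (simp add: algebra_simps)
    from this[of "p / 2"] show ?thesis unfolding \<theta>_0 by simp
  qed
  finally show ?thesis unfolding p_def .
qed

text \<open>The trace of \<open>A\<close> is \<open>T d d\<close>, but also the sum of the
  eigenvalues, which \<open>sum_alternating_odd\<close> evaluates.\<close>

lemma p_eq: "\<theta>p / 2 = T d d / (of_nat d + 1)"
proof -
  have "T d d = \<theta>p / 2 * (of_nat d + 1)"
  proof -
    have "T d d = (\<Sum>i\<le>d. \<theta>p / 2 * ((-1) ^ i * (2 * of_nat d + 1 - 2 * of_nat i)))"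
      unfolding trace(1)[symmetric] by (intro sum.cong refl \<theta>_formula_p) auto
    then show ?thesis
      by (simp only: sum_alternating_odd flip: sum_distrib_left)
  qed
  moreover have "(of_nat d + 1 :: 'k) \<noteq> 0"
    using of_nat_neq_0[of d, where ?'a = 'k] by (simp add: add.commute)
  ultimately show ?thesis by (simp only: nonzero_mult_div_cancel_right not_False_eq_True)
qed

lemma \<theta>_formula:
  assumes "i \<le> d"
  shows "\<theta> i = T d d / (of_nat d + 1) * ((-1) ^ i * (2 * of_nat d + 1 - 2 * of_nat i))"
  using \<theta>_formula_p[OF assms] unfolding p_eq .

lemma \<theta>s_formula:
  assumes "i \<le> d"
  shows "\<theta>s i = Ts d d / (of_nat d + 1) * ((-1) ^ i * (2 * of_nat d + 1 - 2 * of_nat i))"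
proof -
  interpret dual: bannai_ito_system d "\<lambda>i k. Ts k i" "\<lambda>k j. T j k" "\<lambda>i j. X j i" \<theta>s \<theta>
    by (rule dual)
  show ?thesis using dual.\<theta>_formula[OF assms] .
qed

text \<open>Scale factors relative to the folded cube, whose entry at (d, d) is d + 1.\<close>

abbreviation "t \<equiv> T d d / (of_nat d + 1)"
abbreviation "ts \<equiv> Ts d d / (of_nat d + 1)"

section \<open>Products of opposite off-diagonal entries of \<open>T\<close>\<close>

lemma \<theta>s_add:
  assumes "i < d" shows "\<theta>s i + \<theta>s (Suc i) = 2 * ts * (-1) ^ i"
proof -
  define s where "s = ts"
  have s: "\<theta>s i = s * ((-1) ^ i * (2 * of_nat d + 1 - 2 * of_nat i))"
    "\<theta>s (Suc i) = s * ((-1) ^ Suc i * (2 * of_nat d + 1 - 2 * of_nat (Suc i)))"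
    using \<theta>s_formula assms unfolding s_def by (auto simp del: of_nat_Suc)
  show ?thesis
    unfolding s s_def[symmetric] by (simp add: algebra_simps)
qed

text \<open>Half of the equation \<open>C0 i i = 0\<close>. The \<gamma> term drops out since
  \<open>T i i\<close> is zero, and \<rho> is 4 t^2. The sums of \<theta>s i with its two neighbours
  have opposite signs, so the two products enter as a difference.\<close>

lemma T_prod_rec:
  assumes "i < d"
  shows "T i (Suc i) * T (Suc i) i * (2 * ts * (-1) ^ i)
     - (if i = 0 then 0 else T (i - 1) i * T i (i - 1) * (2 * ts * (-1) ^ i)) = 2 * t\<^sup>2 * \<theta>s i"
proof -
  have p: "\<theta>p = 2 * t"
    unfolding p_eq[symmetric] by simp
  have q: "\<theta>q = - (2 * t)"
    using p_plus_q unfolding p by (simp only: add_eq_0_iff)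
  have \<rho>: "- (\<theta>p * \<theta>q) = 2 * (2 * t\<^sup>2)"
    unfolding p q by (simp add: power2_eq_square)
  let ?g = "\<lambda>l. T i l * T l i * (\<theta>s i + 2 * \<theta>s l + \<theta>s i)"
  have "(\<Sum>l\<le>d. ?g l) = (if i = 0 then 0 else ?g (i - 1)) + ?g i + (if i = d then 0 else ?g (Suc i))"
    by (rule sum_tridiagonal) (use assms T_tri in auto)
  also have "?g i = 0"
    using T_diag assms by simp
  also have "?g (Suc i) = 2 * (T i (Suc i) * T (Suc i) i * (\<theta>s i + \<theta>s (Suc i)))"
    by (simp add: algebra_simps)
  also have "\<theta>s i + \<theta>s (Suc i) = 2 * ts * (-1) ^ i"
    using \<theta>s_add assms .
  also have "(if i = 0 then 0 else ?g (i - 1))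
      = - (2 * (if i = 0 then 0 else T (i - 1) i * T i (i - 1) * (2 * ts * (-1) ^ i)))"
  proof (cases i)
    case (Suc j)
    have "?g j = 2 * (T j i * T i j * (\<theta>s j + \<theta>s (Suc j)))"
      using Suc by (simp add: algebra_simps)
    also have "\<theta>s j + \<theta>s (Suc j) = 2 * ts * (-1) ^ j"
      using \<theta>s_add[of j] assms Suc by simp
    finally show ?thesis using Suc by simp
  qed simp
  finally have g: "(\<Sum>l\<le>d. ?g l) = 2 * (T i (Suc i) * T (Suc i) i * (2 * ts * (-1) ^ i)
      - (if i = 0 then 0 else T (i - 1) i * T i (i - 1) * (2 * ts * (-1) ^ i)))"
    using assms by (simp add: right_diff_distrib)
  have C: "C0 i i = (\<Sum>l\<le>d. ?g l) - 2 * (2 * t\<^sup>2 * \<theta>s i)"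
    using T_diag assms unfolding C_def \<rho>
    by (simp only: simp_thms if_True mult_zero_left mult_zero_right diff_zero mult.assoc)
  have "C0 i i = 0" using C0_eq_0 assms by simp
  then have "(\<Sum>l\<le>d. ?g l) = 2 * (2 * t\<^sup>2 * \<theta>s i)"
    unfolding C by (simp only: right_minus_eq)
  then show ?thesis
    unfolding g mult_cancel_left by (simp only: zero_neq_numeral[symmetric] simp_thms)
qed

text \<open>The recurrence telescopes: the odd numbers 2 d + 1 - 2 k for k \<le> i add up to (i + 1)
  (2 d + 1 - i), the product of the intersection numbers c_(i+1) and b_i of the folded cube.\<close>

lemma T_prod:
  assumes "i < d"
  shows "T i (Suc i) * T (Suc i) i = t\<^sup>2 * (of_nat i + 1) * (2 * of_nat d + 1 - of_nat i)"
  using assms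
proof (induction i)
  have "(of_nat d + 1 :: 'k) \<noteq> 0"
    using of_nat_neq_0[of d, where ?'a = 'k] by (simp add: add.commute)
  then have ts0: "ts \<noteq> 0" using Ts_diag by simp
  have diff: "T i (Suc i) * T (Suc i) i - (if i = 0 then 0 else T (i - 1) i * T i (i - 1))
      = t\<^sup>2 * (2 * of_nat d + 1 - 2 * of_nat i)" if "i < d" for i
  proof -
    have "(2 * ts * (-1) ^ i) * (T i (Suc i) * T (Suc i) i - (if i = 0 then 0 else T (i - 1) i * T i (i - 1)))
        = (2 * ts * (-1) ^ i) * (t\<^sup>2 * (2 * of_nat d + 1 - 2 * of_nat i))"
      using T_prod_rec[OF that] \<theta>s_formula[of i] that by (simp add: algebra_simps)
    then show ?thesis using ts0 by (subst (asm) mult_cancel_left) simp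
  qed
  {
    case 0
    then show ?case using diff[of 0] by simp
  next
    case (Suc i)
    define u where "u = t\<^sup>2"
    have "T (Suc i) (Suc (Suc i)) * T (Suc (Suc i)) (Suc i)
        = T i (Suc i) * T (Suc i) i + u * (2 * of_nat d + 1 - 2 * of_nat (Suc i))"
      using diff[OF Suc.prems] unfolding u_def
      by (simp only: nat.distinct if_False diff_Suc_1 diff_eq_eq) (rule add.commute)
    also have "T i (Suc i) * T (Suc i) i = u * (of_nat i + 1) * (2 * of_nat d + 1 - of_nat i)"
      unfolding u_def using Suc by simp
    finally show ?case
      unfolding u_def[symmetric] by (simp add: algebra_simps)
  }
qed

end

subsection \<open>Matrices with respect to indexed bases\<close>


definition irreducible_tridiagonal :: "nat \<Rightarrow> (nat \<Rightarrow> nat \<Rightarrow> 'a::zero) \<Rightarrow> bool" where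
  "irreducible_tridiagonal d T \<longleftrightarrow>
     (\<forall>i\<le>d. \<forall>k\<le>d. \<not> (i = k \<or> i = Suc k \<or> k = Suc i) \<longrightarrow> T i k = 0) \<and>
     (\<forall>i<d. T i (Suc i) \<noteq> 0 \<and> T (Suc i) i \<noteq> 0)"

lemma irreducible_tridiagonal_mat_iff:
  assumes "M \<in> carrier_mat (Suc d) (Suc d)"
  shows "irreducible_tridiagonal_mat M \<longleftrightarrow> irreducible_tridiagonal d (\<lambda>i j. M $$ (i, j))"
  using assms
  unfolding irreducible_tridiagonal_mat_def irreducible_tridiagonal_def tridiagonal_mat_def
  by (auto simp: less_Suc_eq_le)

lemma irreducible_tridiagonal_reverse:
  assumes "irreducible_tridiagonal d T"
  shows "irreducible_tridiagonal d (\<lambda>i j. T (d - i) (d - j))"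
  unfolding irreducible_tridiagonal_def
proof (intro conjI allI impI)
  fix i k assume "i \<le> d" "k \<le> d" "\<not> (i = k \<or> i = Suc k \<or> k = Suc i)"
  then have "\<not> (d - i = d - k \<or> d - i = Suc (d - k) \<or> d - k = Suc (d - i))" by arith
  then show "T (d - i) (d - k) = 0"
    using assms by (simp add: irreducible_tridiagonal_def)
next
  fix i assume i: "i < d"
  then have "d - i = Suc (d - Suc i)" "d - Suc i < d" by auto
  then show "T (d - i) (d - Suc i) \<noteq> 0" "T (d - Suc i) (d - i) \<noteq> 0"
    using assms unfolding irreducible_tridiagonal_def by auto
qed

text \<open>An injective walk on a path never turns back, so all steps go in the same direction; d
  steps inside {0..d} then leave only one starting point.\<close>

lemma path_automorphism:
  fixes \<sigma> :: "nat \<Rightarrow> nat"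
  assumes inj: "inj_on \<sigma> {..d}" and le: "\<And>i. i \<le> d \<Longrightarrow> \<sigma> i \<le> d"
    and adj: "\<And>i. i < d \<Longrightarrow> \<sigma> (Suc i) = Suc (\<sigma> i) \<or> \<sigma> i = Suc (\<sigma> (Suc i))"
  shows "(\<forall>i\<le>d. \<sigma> i = i) \<or> (\<forall>i\<le>d. \<sigma> i = d - i)"
proof -
  have same: "\<sigma> (Suc (Suc i)) = Suc (\<sigma> (Suc i)) \<longleftrightarrow> \<sigma> (Suc i) = Suc (\<sigma> i)" if "Suc i < d" for i
  proof -
    have "\<sigma> (Suc (Suc i)) \<noteq> \<sigma> i"
      using inj_onD[OF inj, of "Suc (Suc i)" i] that by auto
    then show ?thesis using adj[OF Suc_lessD[OF that]] adj[OF that] by arith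
  qed
  have dir: "\<sigma> (Suc i) = Suc (\<sigma> i) \<longleftrightarrow> \<sigma> (Suc 0) = Suc (\<sigma> 0)" if "i < d" for i
    using that
  proof (induction i)
    case (Suc i)
    then show ?case using same[of i] by simp
  qed simp
  show ?thesis
  proof (cases "\<sigma> (Suc 0) = Suc (\<sigma> 0)")
    case True
    have "\<sigma> i = \<sigma> 0 + i" if "i \<le> d" for i
      using that
    proof (induction i)
      case (Suc i)
      then show ?case using dir[of i] True by simp
    qed simp
    note sum = this
    have "\<sigma> i = i" if "i \<le> d" for i
      using sum[of d] sum[OF that] le[of d] by arith
    then show ?thesis by blast
  next
    case False
    have "\<sigma> 0 = \<sigma> i + i" if "i \<le> d" for i
      using that
    proof (induction i)
      case (Suc i)
      then have "\<sigma> i = Suc (\<sigma> (Suc i))" using adj[of i] dir[of i] False by simp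
      then show ?case using Suc by simp
    qed simp
    note sum = this
    have "\<sigma> i = d - i" if "i \<le> d" for i
      using sum[of d] sum[OF that] le[of 0] by arith
    then show ?thesis by blast
  qed
qed

text \<open>
  The intersection numbers of the folded \<open>(2 d + 1)\<close>-cube: \<open>c\<^sub>j = j\<close> above the diagonal,
  \<open>b\<^sub>j = 2 d + 1 - j\<close> below it, and \<open>a\<^sub>d = d + 1\<close>. The eigenvalues below are in the order that makes
  the pair of Bannai/Ito type, not in decreasing order.
\<close>

definition folded_cube_entry :: "nat \<Rightarrow> nat \<Rightarrow> nat \<Rightarrow> 'a::comm_ring_1" where
  "folded_cube_entry d i j =
     (if Suc i = j then of_nat j
      else if i = Suc j then 2 * of_nat d + 1 - of_nat j
      else if i = j \<and> i = d then of_nat d + 1 else 0)"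

definition folded_cube_eigenvalue :: "nat \<Rightarrow> nat \<Rightarrow> 'a::comm_ring_1" where
  "folded_cube_eigenvalue d j = (-1) ^ j * (2 * of_nat d + 1 - 2 * of_nat j)"

context ambient_space
begin

notation scale (infixr "*s" 75)

lemma linear_between_sum:
  assumes V: "subspace V" and f: "linear_between (*s) t V W f"
    and "vector_space t" "finite I" "\<And>i. i \<in> I \<Longrightarrow> x i \<in> V"
  shows "f (\<Sum>i\<in>I. c i *s x i) = (\<Sum>i\<in>I. t (c i) (f (x i)))"
proof -
  have "f (0 + 0) = f 0 + f 0"
    using f subspace_0[OF V] unfolding linear_between_def by blast
  then have f0: "f 0 = 0" by simp
  show ?thesis
    using assms(4,5)
  proof (induction I rule: finite_induct)
    case (insert i I)
    have "(\<Sum>i\<in>I. c i *s x i) \<in> V" "c i *s x i \<in> V"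
      using insert by (auto intro: subspace_sum[OF V] subspace_scale[OF V])
    then show ?case
      using insert f by (simp add: linear_between_def)
  qed (simp add: f0)
qed

text \<open>A relational counterpart of \<open>matrix_wrt\<close>: it avoids
  \<open>representation\<close>, and entries of \<open>M\<close> outside the index range do not
  matter, so matrices can be given by closed formulas.\<close>

definition has_matrix :: "nat \<Rightarrow> (nat \<Rightarrow> 'b) \<Rightarrow> ('b \<Rightarrow> 'b) \<Rightarrow> (nat \<Rightarrow> nat \<Rightarrow> 'a) \<Rightarrow> bool" where
  "has_matrix d v A M \<longleftrightarrow> (\<forall>j\<le>d. A (v j) = (\<Sum>i\<le>d. M i j *s v i))"

lemma has_matrixD: "has_matrix d v A M \<Longrightarrow> j \<le> d \<Longrightarrow> A (v j) = (\<Sum>i\<le>d. M i j *s v i)"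
  by (simp add: has_matrix_def)

lemma has_matrix_diagonal:
  "has_matrix d v A (\<lambda>i j. if i = j then \<theta> j else 0) \<longleftrightarrow> (\<forall>j\<le>d. A (v j) = \<theta> j *s v j)"
proof -
  have "(\<Sum>i\<le>d. (if i = j then \<theta> j else 0) *s v i) = \<theta> j *s v j" if "j \<le> d" for j
    using that by (subst sum.mono_neutral_right[of _ "{j}"]) auto
  then show ?thesis by (simp add: has_matrix_def)
qed

definition basis_upto :: "nat \<Rightarrow> 'b set \<Rightarrow> (nat \<Rightarrow> 'b) \<Rightarrow> bool" where
  "basis_upto d V v \<longleftrightarrow> indexed_basis V v \<and> dim V = Suc d"

lemma basis_upto_subspace: "basis_upto d V v \<Longrightarrow> subspace V"
  unfolding basis_upto_def indexed_basis_def by (metis subspace_span)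

lemma basis_upto_in: "basis_upto d V v \<Longrightarrow> i \<le> d \<Longrightarrow> v i \<in> V"
  unfolding basis_upto_def indexed_basis_def
  by (metis imageI lessThan_iff less_Suc_eq_le span_base)

lemma basis_upto_eq_0:
  assumes v: "basis_upto d V v" and "(\<Sum>i\<le>d. f i *s v i) = 0" "i \<le> d"
  shows "f i = 0"
proof -
  have inj: "inj_on v {..d}" and ind: "independent (v ` {..d})"
    using v by (auto simp: basis_upto_def indexed_basis_def lessThan_Suc_atMost)
  have "(\<Sum>x\<in>v ` {..d}. f (the_inv_into {..d} v x) *s x) = (\<Sum>i\<le>d. f i *s v i)"
    by (subst sum.reindex[OF inj]) (auto intro!: sum.cong simp: the_inv_into_f_f[OF inj])
  then have "f (the_inv_into {..d} v (v i)) = 0"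
    using independentD[OF ind, of "v ` {..d}" "\<lambda>x. f (the_inv_into {..d} v x)" "v i"] assms by auto
  then show ?thesis using the_inv_into_f_f[OF inj] assms by simp
qed

lemma basis_upto_eqD:
  assumes v: "basis_upto d V v" and "(\<Sum>i\<le>d. f i *s v i) = (\<Sum>i\<le>d. g i *s v i)" "i \<le> d"
  shows "f i = g i"
  using basis_upto_eq_0[OF v, of "\<lambda>i. f i - g i" i] assms
  by (simp add: scale_left_diff_distrib sum_subtractf)

lemma basis_upto_representation:
  assumes v: "basis_upto d V v" and "x \<in> V"
  shows "x = (\<Sum>i\<le>d. representation (v ` {..<dim V}) x (v i) *s v i)"
proof -
  have inj: "inj_on v {..d}" and ind: "independent (v ` {..d})" and sp: "x \<in> span (v ` {..d})"
    and d: "{..<dim V} = {..d}"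
    using v \<open>x \<in> V\<close> by (auto simp: basis_upto_def indexed_basis_def lessThan_Suc_atMost)
  have "x = (\<Sum>b\<in>v ` {..d}. representation (v ` {..d}) x b *s b)"
    using sum_representation_eq[OF ind sp, of "v ` {..d}"] by simp
  then show ?thesis by (simp add: sum.reindex[OF inj] d)
qed

lemma basis_upto_expand:
  assumes "basis_upto d V v" "x \<in> V"
  obtains f where "x = (\<Sum>i\<le>d. f i *s v i)"
  by (rule that[OF basis_upto_representation[OF assms]])

lemma sum_in_basis_upto: "basis_upto d V v \<Longrightarrow> (\<Sum>i\<le>d. f i *s v i) \<in> V"
  using basis_upto_subspace basis_upto_in by (intro subspace_sum subspace_scale) auto

lemma independent_family:
  fixes v :: "nat \<Rightarrow> 'b"
  assumes ind: "\<And>f i. (\<Sum>i\<le>d. f i *s v i) = 0 \<Longrightarrow> i \<le> d \<Longrightarrow> f i = 0"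
  shows "inj_on v {..d}" "independent (v ` {..d})"
proof -
  show inj: "inj_on v {..d}"
  proof (rule inj_onI, rule ccontr)
    fix i j assume ij: "i \<in> {..d}" "j \<in> {..d}" "v i = v j" "i \<noteq> j"
    have "(\<Sum>k\<le>d. ((if k = i then 1 else 0) - (if k = j then 1 else 0)) *s v k) = v i - v j"
      using ij by (simp add: scale_left_diff_distrib sum_subtractf if_distrib[of "\<lambda>c. c *s _"] cong: if_cong)
    from ind[OF this[unfolded ij(3) diff_self], of i] ij show False by auto
  qed
  show "independent (v ` {..d})"
  proof (rule independent_if_scalars_zero)
    fix f x assume *: "(\<Sum>x\<in>v ` {..d}. f x *s x) = 0" "x \<in> v ` {..d}"
    then show "f x = 0"
      using ind[of "\<lambda>i. f (v i)"] by (auto simp: sum.reindex[OF inj])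
  qed auto
qed

lemma basis_uptoI:
  assumes V: "subspace V" and in_V: "\<And>i. i \<le> d \<Longrightarrow> v i \<in> V"
    and ind: "\<And>f i. (\<Sum>i\<le>d. f i *s v i) = 0 \<Longrightarrow> i \<le> d \<Longrightarrow> f i = 0"
    and expand: "\<And>x. x \<in> V \<Longrightarrow> \<exists>f. x = (\<Sum>i\<le>d. f i *s v i)"
  shows "basis_upto d V v"
proof -
  have inj: "inj_on v {..d}" and "independent (v ` {..d})"
    by (rule independent_family, erule ind, assumption)+
  have sp: "span (v ` {..d}) = V"
  proof
    show "span (v ` {..d}) \<subseteq> V" using V in_V by (intro span_minimal) auto
    show "V \<subseteq> span (v ` {..d})"
    proof
      fix x assume "x \<in> V"
      then obtain f where "x = (\<Sum>i\<le>d. f i *s v i)" using expand by blast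
      then show "x \<in> span (v ` {..d})" by (auto intro: span_sum span_scale span_base)
    qed
  qed
  have "dim V = Suc d"
    using \<open>independent _\<close> sp dim_span_eq_card_independent[of "v ` {..d}"] card_image[OF inj] by simp
  then show ?thesis
    using inj sp \<open>independent _\<close> by (simp add: basis_upto_def indexed_basis_def lessThan_Suc_atMost)
qed

lemma basis_upto_reverse:
  assumes "basis_upto d V v" shows "basis_upto d V (\<lambda>i. v (d - i))"
proof -
  have bij: "bij_betw (\<lambda>i. d - i) {..d} {..d}"
    by (rule bij_betwI[where g = "\<lambda>i. d - i"]) auto
  then have "(\<lambda>i. v (d - i)) ` {..d} = v ` {..d}"
    unfolding bij_betw_def by (metis image_image)
  moreover have "inj_on (\<lambda>i. v (d - i)) {..d}"
  proof (rule inj_onI)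
    fix i j assume ij: "i \<in> {..d}" "j \<in> {..d}" "v (d - i) = v (d - j)"
    have "inj_on v {..d}"
      using assms by (auto simp: basis_upto_def indexed_basis_def lessThan_Suc_atMost)
    from inj_onD[OF this ij(3)] ij show "i = j" by auto
  qed
  ultimately show ?thesis
    using assms by (auto simp: basis_upto_def indexed_basis_def lessThan_Suc_atMost)
qed

lemma basis_upto_scale:
  assumes v: "basis_upto d V v" and c: "\<And>i. i \<le> d \<Longrightarrow> c i \<noteq> 0"
  shows "basis_upto d V (\<lambda>i. c i *s v i)"
proof (rule basis_uptoI)
  show "subspace V" using v by (rule basis_upto_subspace)
  then show "c i *s v i \<in> V" if "i \<le> d" for i
    using basis_upto_in[OF v that] by (rule subspace_scale)
  show "f i = 0" if "(\<Sum>i\<le>d. f i *s c i *s v i) = 0" "i \<le> d" for f i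
    using basis_upto_eq_0[OF v, of "\<lambda>i. f i * c i" i] that c[of i] by simp
  show "\<exists>f. x = (\<Sum>i\<le>d. f i *s c i *s v i)" if "x \<in> V" for x
  proof -
    obtain f where "x = (\<Sum>i\<le>d. f i *s v i)" using basis_upto_expand[OF v \<open>x \<in> V\<close>] .
    also have "\<dots> = (\<Sum>i\<le>d. (f i / c i) *s c i *s v i)"
      by (intro sum.cong refl) (simp add: c)
    finally show ?thesis by (rule exI[of _ "\<lambda>i. f i / c i"])
  qed
qed

lemma has_matrix_reverse:
  assumes "has_matrix d v A M"
  shows "has_matrix d (\<lambda>i. v (d - i)) A (\<lambda>i j. M (d - i) (d - j))"
proof -
  have rev: "(\<Sum>i\<le>d. f (d - i)) = (\<Sum>i\<le>d. f i)" for f :: "nat \<Rightarrow> 'b"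
    by (rule sum.reindex_bij_witness[where i = "\<lambda>i. d - i" and j = "\<lambda>i. d - i"]) auto
  show ?thesis
    unfolding has_matrix_def
  proof (intro allI impI)
    fix j
    show "A (v (d - j)) = (\<Sum>i\<le>d. M (d - i) (d - j) *s v (d - i))"
      using has_matrixD[OF assms, of "d - j"] rev[of "\<lambda>i. M i (d - j) *s v i"] by simp
  qed
qed

lemma has_matrix_matrix_wrt:
  assumes "basis_upto d V v" "linear_between (*s) (*s) V V A"
  shows "has_matrix d v A (\<lambda>i j. matrix_wrt V v A $$ (i, j))"
  unfolding has_matrix_def
proof (intro allI impI)
  fix j assume "j \<le> d"
  then have "A (v j) \<in> V"
    using assms basis_upto_in by (auto simp: linear_between_def)
  from basis_upto_representation[OF assms(1) this] \<open>j \<le> d\<close> assms(1)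
  show "A (v j) = (\<Sum>i\<le>d. matrix_wrt V v A $$ (i, j) *s v i)"
    by (simp add: matrix_wrt_def basis_upto_def)
qed

lemma matrix_wrt_eq:
  assumes v: "basis_upto d V v" and "has_matrix d v A M" "i \<le> d" "j \<le> d"
  shows "matrix_wrt V v A $$ (i, j) = M i j"
proof -
  have "A (v j) \<in> V"
    using assms sum_in_basis_upto[OF v] by (simp add: has_matrix_def)
  from basis_upto_representation[OF v this]
  have "A (v j) = (\<Sum>i\<le>d. matrix_wrt V v A $$ (i, j) *s v i)"
    using assms by (simp add: matrix_wrt_def basis_upto_def)
  then show ?thesis
    using basis_upto_eqD[OF v, of "\<lambda>i. matrix_wrt V v A $$ (i, j)" "\<lambda>i. M i j"] assms
    by (simp add: has_matrix_def)
qed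

lemma matrix_wrt_carrier: "basis_upto d V v \<Longrightarrow> matrix_wrt V v A \<in> carrier_mat (Suc d) (Suc d)"
  by (simp add: matrix_wrt_def basis_upto_def)

text \<open>Coordinates in a basis are unique, so the matrices in the definition may be replaced by
  any \<theta> and \<open>M\<close> that describe the two maps.\<close>

lemma standard_basis_iff:
  assumes "linear_between (*s) (*s) V V A" "linear_between (*s) (*s) V V As" "dim V = Suc d"
  shows "standard_basis V A As v \<longleftrightarrow> basis_upto d V v \<and> (\<exists>\<theta>. \<forall>j\<le>d. A (v j) = \<theta> j *s v j) \<and>
    (\<exists>M. has_matrix d v As M \<and> irreducible_tridiagonal d M)"
proof (cases "basis_upto d V v")
  case True
  have "diagonal_mat (matrix_wrt V v A) \<longleftrightarrow> (\<exists>\<theta>. has_matrix d v A (\<lambda>i j. if i = j then \<theta> j else 0))"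
  proof
    assume diag: "diagonal_mat (matrix_wrt V v A)"
    have "has_matrix d v A (\<lambda>i j. if i = j then matrix_wrt V v A $$ (j, j) else 0)"
      unfolding has_matrix_def
    proof (intro allI impI)
      fix j assume "j \<le> d"
      then have "A (v j) = (\<Sum>i\<le>d. matrix_wrt V v A $$ (i, j) *s v i)"
        using has_matrix_matrix_wrt[OF True assms(1)] by (simp add: has_matrix_def)
      also have "\<dots> = (\<Sum>i\<le>d. (if i = j then matrix_wrt V v A $$ (j, j) else 0) *s v i)"
        using diag \<open>j \<le> d\<close> matrix_wrt_carrier[OF True, of A]
        by (intro sum.cong) (auto simp: diagonal_mat_def less_Suc_eq_le)
      finally show "A (v j) = \<dots>" .
    qed
    then show "\<exists>\<theta>. has_matrix d v A (\<lambda>i j. if i = j then \<theta> j else 0)"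
      by (rule exI[of _ "\<lambda>j. matrix_wrt V v A $$ (j, j)"])
  next
    assume "\<exists>\<theta>. has_matrix d v A (\<lambda>i j. if i = j then \<theta> j else 0)"
    then show "diagonal_mat (matrix_wrt V v A)"
      using matrix_wrt_eq[OF True] matrix_wrt_carrier[OF True, of A]
      by (auto simp: diagonal_mat_def less_Suc_eq_le)
  qed
  moreover have "irreducible_tridiagonal_mat (matrix_wrt V v As) \<longleftrightarrow>
      (\<exists>M. has_matrix d v As M \<and> irreducible_tridiagonal d M)"
  proof -
    let ?N = "\<lambda>i j. matrix_wrt V v As $$ (i, j)"
    have eq: "irreducible_tridiagonal d M \<longleftrightarrow> irreducible_tridiagonal d (\<lambda>i j. matrix_wrt V v As $$ (i, j))"
      if "has_matrix d v As M" for M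
      using matrix_wrt_eq[OF True that] by (simp add: irreducible_tridiagonal_def)
    show ?thesis
      unfolding irreducible_tridiagonal_mat_iff[OF matrix_wrt_carrier[OF True]]
    proof
      assume "irreducible_tridiagonal d ?N"
      with has_matrix_matrix_wrt[OF True assms(2)]
      show "\<exists>M. has_matrix d v As M \<and> irreducible_tridiagonal d M"
        by (intro exI[of _ ?N] conjI)
    next
      assume "\<exists>M. has_matrix d v As M \<and> irreducible_tridiagonal d M"
      then obtain M where "has_matrix d v As M" "irreducible_tridiagonal d M" by (elim exE conjE)
      then show "irreducible_tridiagonal d ?N" using eq by iprover
    qed
  qed
  ultimately show ?thesis
    using True by (simp add: standard_basis_def basis_upto_def has_matrix_diagonal)
next
  case False
  then show ?thesis using assms by (simp add: standard_basis_def basis_upto_def)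
qed

lemma change_of_basis:
  assumes v: "basis_upto d V v" and w: "basis_upto d V w"
  obtains X Y where
    "\<forall>j\<le>d. w j = (\<Sum>i\<le>d. X i j *s v i)"
    "\<forall>i\<le>d. \<forall>j\<le>d. (\<Sum>k\<le>d. X i k * Y k j) = (if i = j then 1 else 0)"
    "\<forall>i\<le>d. \<forall>j\<le>d. (\<Sum>k\<le>d. Y i k * X k j) = (if i = j then 1 else 0)"
proof -
  define X where "X i j = representation (v ` {..<dim V}) (w j) (v i)" for i j
  define Y where "Y i j = representation (w ` {..<dim V}) (v j) (w i)" for i j
  have X: "w j = (\<Sum>i\<le>d. X i j *s v i)" if "j \<le> d" for j
    unfolding X_def by (rule basis_upto_representation[OF v basis_upto_in[OF w that]])
  have Y: "v j = (\<Sum>i\<le>d. Y i j *s w i)" if "j \<le> d" for j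
    unfolding Y_def by (rule basis_upto_representation[OF w basis_upto_in[OF v that]])
  \<comment> \<open>Used for \<open>v\<close> and for \<open>w\<close>, to get both X Y = 1 and Y X
    = 1.\<close>
  have prod: "(\<Sum>k\<le>d. P i k * Q k j) = (if i = j then 1 else 0)"
    if u: "basis_upto d V u" and P: "\<And>j. j \<le> d \<Longrightarrow> z j = (\<Sum>i\<le>d. P i j *s u i)"
      and Q: "\<And>j. j \<le> d \<Longrightarrow> u j = (\<Sum>i\<le>d. Q i j *s z i)" and "i \<le> d" "j \<le> d"
    for P Q :: "nat \<Rightarrow> nat \<Rightarrow> 'a" and u z i j
  proof (rule basis_upto_eqD[OF u _ \<open>i \<le> d\<close>])
    have "(\<Sum>i\<le>d. (\<Sum>k\<le>d. P i k * Q k j) *s u i) = (\<Sum>k\<le>d. Q k j *s (\<Sum>i\<le>d. P i k *s u i))"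
      by (simp add: scale_sum_left scale_sum_right mult.commute) (rule sum.swap)
    also have "\<dots> = (\<Sum>k\<le>d. Q k j *s z k)"
      by (intro sum.cong refl, subst P) auto
    also have "\<dots> = u j" using Q \<open>j \<le> d\<close> by simp
    also have "\<dots> = (\<Sum>i\<le>d. (if i = j then 1 else 0) *s u i)"
      using \<open>j \<le> d\<close> by (subst sum.mono_neutral_right[of _ "{j}"]) auto
    finally show "(\<Sum>i\<le>d. (\<Sum>k\<le>d. P i k * Q k j) *s u i) = \<dots>" .
  qed
  show thesis
    by (rule that[of X Y]; intro allI impI) (rule X prod[OF v X Y] prod[OF w Y X]; assumption)+
qed

text \<open>Both sides are the coordinates of \<open>A (w j)\<close> in the basis \<open>v\<close>;
  in matrix form M X = X N.\<close>

lemma has_matrix_change_of_basis: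
  assumes v: "basis_upto d V v" and A: "linear_between (*s) (*s) V V A"
    and M: "has_matrix d v A M" and N: "has_matrix d w A N"
    and X: "\<And>j. j \<le> d \<Longrightarrow> w j = (\<Sum>i\<le>d. X i j *s v i)" and "i \<le> d" "j \<le> d"
  shows "(\<Sum>k\<le>d. M i k * X k j) = (\<Sum>k\<le>d. X i k * N k j)"
proof (rule basis_upto_eqD[OF v _ \<open>i \<le> d\<close>])
  have "(\<Sum>i\<le>d. (\<Sum>k\<le>d. M i k * X k j) *s v i) = (\<Sum>k\<le>d. X k j *s (\<Sum>i\<le>d. M i k *s v i))"
    by (simp add: scale_sum_left scale_sum_right mult.commute) (rule sum.swap)
  also have "\<dots> = (\<Sum>k\<le>d. X k j *s A (v k))"
    using M by (intro sum.cong) (simp_all add: has_matrix_def)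
  also have "\<dots> = A (w j)"
    using \<open>j \<le> d\<close> basis_upto_in[OF v]
    by (subst X, simp, subst linear_between_sum[OF basis_upto_subspace[OF v] A vector_space_axioms]) auto
  also have "\<dots> = (\<Sum>k\<le>d. N k j *s (\<Sum>i\<le>d. X i k *s v i))"
    unfolding has_matrixD[OF N \<open>j \<le> d\<close>] by (intro sum.cong refl, subst X) auto
  also have "\<dots> = (\<Sum>i\<le>d. (\<Sum>k\<le>d. X i k * N k j) *s v i)"
    by (simp add: scale_sum_left scale_sum_right mult.commute) (rule sum.swap)
  finally show "(\<Sum>i\<le>d. (\<Sum>k\<le>d. M i k * X k j) *s v i) = \<dots>" .
qed

text \<open>tr M = tr (M X Y) = tr (X N Y) = tr (N Y X) = tr N.\<close>

lemma trace_invariant: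
  assumes v: "basis_upto d V v" and w: "basis_upto d V w" and A: "linear_between (*s) (*s) V V A"
    and M: "has_matrix d v A M" and N: "has_matrix d w A N"
  shows "(\<Sum>i\<le>d. M i i) = (\<Sum>i\<le>d. N i i)"
proof -
  obtain X Y where X: "\<forall>j\<le>d. w j = (\<Sum>i\<le>d. X i j *s v i)"
    and XY: "\<forall>i\<le>d. \<forall>j\<le>d. (\<Sum>k\<le>d. X i k * Y k j) = (if i = j then 1 else 0)"
    and YX: "\<forall>i\<le>d. \<forall>j\<le>d. (\<Sum>k\<le>d. Y i k * X k j) = (if i = j then 1 else 0)"
    using change_of_basis[OF v w] .
  note MX = has_matrix_change_of_basis[OF v A M N X[rule_format]]
  have "(\<Sum>i\<le>d. M i i) = (\<Sum>i\<le>d. \<Sum>k\<le>d. M i k * (\<Sum>l\<le>d. X k l * Y l i))"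
    by (intro sum.cong refl, simp add: XY if_distrib[of "\<lambda>x. _ * x"] cong: if_cong)
  also have "\<dots> = (\<Sum>i\<le>d. \<Sum>l\<le>d. (\<Sum>k\<le>d. M i k * X k l) * Y l i)"
    by (rule sum.cong[OF refl], simp add: sum_distrib_left sum_distrib_right mult.assoc) (rule sum.swap)
  also have "\<dots> = (\<Sum>i\<le>d. \<Sum>l\<le>d. (\<Sum>k\<le>d. X i k * N k l) * Y l i)"
    by (intro sum.cong refl) (simp add: MX)
  also have "\<dots> = (\<Sum>l\<le>d. \<Sum>k\<le>d. N k l * (\<Sum>i\<le>d. Y l i * X i k))"
    by (subst sum.swap, rule sum.cong[OF refl])
      (simp add: sum_distrib_left sum_distrib_right mult_ac, rule sum.swap)
  also have "\<dots> = (\<Sum>l\<le>d. N l l)"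
    by (intro sum.cong refl, simp add: YX if_distrib[of "\<lambda>x. _ * x"] cong: if_cong)
  finally show ?thesis .
qed

lemma trace_on_eq:
  assumes v: "basis_upto d V v" and A: "linear_between (*s) (*s) V V A" and M: "has_matrix d v A M"
  shows "trace_on V A = (\<Sum>i\<le>d. M i i)"
proof -
  define w where "w = (SOME v. indexed_basis V v)"
  have "indexed_basis V w"
    unfolding w_def using v by (intro someI[of "indexed_basis V" v]) (simp add: basis_upto_def)
  then have w: "basis_upto d V w" using v by (simp add: basis_upto_def)
  have "trace_on V A = (\<Sum>i\<le>d. matrix_wrt V w A $$ (i, i))"
    using matrix_wrt_carrier[OF w, of A]
    by (simp add: trace_on_def mat_trace_def w_def lessThan_Suc_atMost)
  then show ?thesis
    using trace_invariant[OF w v A has_matrix_matrix_wrt[OF w A] M] by simp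
qed

end


section \<open>Order of the eigenspaces, unique up to reversal\<close>

context ambient_space
begin

lemma has_matrix_apply:
  assumes v: "basis_upto d V v" and A: "linear_between (*s) (*s) V V A" and M: "has_matrix d v A M"
  shows "A (\<Sum>k\<le>d. f k *s v k) = (\<Sum>i\<le>d. (\<Sum>k\<le>d. M i k * f k) *s v i)"
proof -
  have "A (\<Sum>k\<le>d. f k *s v k) = (\<Sum>k\<le>d. f k *s A (v k))"
    using basis_upto_in[OF v]
    by (intro linear_between_sum[OF basis_upto_subspace[OF v] A vector_space_axioms]) auto
  also have "\<dots> = (\<Sum>k\<le>d. f k *s (\<Sum>i\<le>d. M i k *s v i))"
    using has_matrixD[OF M] by (intro sum.cong) auto
  also have "\<dots> = (\<Sum>i\<le>d. (\<Sum>k\<le>d. M i k * f k) *s v i)"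
    by (simp add: scale_sum_left scale_sum_right mult.commute) (rule sum.swap)
  finally show ?thesis .
qed

lemma eigenvector_eq_0:
  assumes v: "basis_upto d V v" and A: "linear_between (*s) (*s) V V A"
    and T: "has_matrix d v A T" "irreducible_tridiagonal d T"
    and eig: "A (\<Sum>k\<le>d. f k *s v k) = c *s (\<Sum>k\<le>d. f k *s v k)" and "f 0 = 0"
  shows "(\<Sum>k\<le>d. f k *s v k) = 0"
proof -
  have Tf: "(\<Sum>k\<le>d. T i k * f k) = c * f i" if "i \<le> d" for i
    using eig unfolding has_matrix_apply[OF v A T(1)]
    by (intro basis_upto_eqD[OF v _ that]) (simp add: scale_sum_right)
  have "f i = 0" if "i \<le> d" for i
    using T(2) by (intro tridiagonal_eigenvector_eq_0[OF _ _ Tf \<open>f 0 = 0\<close> that])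
      (auto simp: irreducible_tridiagonal_def)
  then show ?thesis by simp
qed

text \<open>Subtracting from \<open>y\<close> the multiple of \<open>x\<close> that cancels the
  coordinate at index 0 leaves an eigenvector to which \<open>eigenvector_eq_0\<close>
  applies.\<close>

lemma eigenvectors_proportional:
  assumes v: "basis_upto d V v" and A: "linear_between (*s) (*s) V V A"
    and T: "has_matrix d v A T" "irreducible_tridiagonal d T"
    and x: "x \<in> V" "A x = c *s x" "x \<noteq> 0" and y: "y \<in> V" "A y = c *s y"
  obtains k where "y = k *s x"
proof -
  obtain f where f: "x = (\<Sum>k\<le>d. f k *s v k)" using basis_upto_expand[OF v x(1)] .
  obtain g where g: "y = (\<Sum>k\<le>d. g k *s v k)" using basis_upto_expand[OF v y(1)] .
  have f0: "f 0 \<noteq> 0"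
    using eigenvector_eq_0[OF v A T, of f c] x f by auto
  define h where "h = (\<lambda>k. g k - g 0 / f 0 * f k)"
  have h: "(\<Sum>k\<le>d. h k *s v k) = y - (g 0 / f 0) *s x"
    unfolding f g h_def by (simp add: scale_left_diff_distrib sum_subtractf scale_sum_right)
  have in_V: "(- (g 0 / f 0)) *s x \<in> V"
    using basis_upto_subspace[OF v] x(1) by (rule subspace_scale)
  have "A (y + (- (g 0 / f 0)) *s x) = A y + (- (g 0 / f 0)) *s A x"
    using A y(1) x(1) in_V unfolding linear_between_def by metis
  then have "A (y - (g 0 / f 0) *s x) = c *s (y - (g 0 / f 0) *s x)"
    using x(2) y(2) by (simp add: scale_right_diff_distrib mult.commute)
  then have "y - (g 0 / f 0) *s x = 0"
    using eigenvector_eq_0[OF v A T, of h c] f0 unfolding h by (simp add: h_def)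
  then have "y = (g 0 / f 0) *s x" by simp
  then show thesis by (rule that)
qed

text \<open>The tridiagonal shape of \<open>As\<close> makes the eigenspaces of \<open>A\<close> into a path graph.\<close>

lemma standard_order_unique:
  assumes A: "linear_between (*s) (*s) V V A" and As: "linear_between (*s) (*s) V V As"
    and v: "basis_upto d V v" "\<And>j. j \<le> d \<Longrightarrow> A (v j) = \<theta> j *s v j"
      "has_matrix d v As M" "irreducible_tridiagonal d M"
    and w: "basis_upto d V w" "\<And>j. j \<le> d \<Longrightarrow> A (w j) = \<eta> j *s w j"
      "has_matrix d w As N" "irreducible_tridiagonal d N"
    and vs: "basis_upto d V vs" "has_matrix d vs A T" "irreducible_tridiagonal d T"
  shows "(\<forall>i\<le>d. \<eta> i = \<theta> i) \<or> (\<forall>i\<le>d. \<eta> i = \<theta> (d - i))"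
proof -
  have nz: "u i \<noteq> 0" if "basis_upto d V u" "i \<le> d" for u i
  proof
    assume "u i = 0"
    then have "(\<Sum>k\<le>d. (if k = i then 1 else 0) *s u k) = 0"
      by (intro sum.neutral) auto
    from basis_upto_eq_0[OF that(1) this that(2)] show False by simp
  qed
  \<comment> \<open>Any \<open>v k\<close> that occurs in \<open>w i\<close> has the same
    eigenvalue, and the eigenspaces of \<open>A\<close> are lines because its matrix in
    \<open>vs\<close> is irreducible tridiagonal.\<close>
  have "\<exists>k\<le>d. \<exists>c. c \<noteq> 0 \<and> w i = c *s v k" if i: "i \<le> d" for i
  proof -
    obtain f where f: "w i = (\<Sum>k\<le>d. f k *s v k)"
      using basis_upto_expand[OF v(1) basis_upto_in[OF w(1) i]] .
    have diag: "has_matrix d v A (\<lambda>i j. if i = j then \<theta> j else 0)"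
      using v(2) by (simp add: has_matrix_diagonal)
    have eig: "\<theta> k * f k = \<eta> i * f k" if "k \<le> d" for k
    proof -
      have "(\<Sum>k\<le>d. (\<eta> i * f k) *s v k) = A (w i)"
        using w(2)[OF i] f by (simp add: scale_sum_right)
      also have "\<dots> = (\<Sum>k\<le>d. (\<Sum>l\<le>d. (if k = l then \<theta> l else 0) * f l) *s v k)"
        unfolding f by (rule has_matrix_apply[OF v(1) A diag])
      also have "\<dots> = (\<Sum>k\<le>d. (\<theta> k * f k) *s v k)"
        by (intro sum.cong refl) (simp add: if_distrib[of "\<lambda>x. x * _"] cong: if_cong)
      finally show ?thesis using basis_upto_eqD[OF v(1) _ that] by metis
    qed
    obtain k where k: "k \<le> d" "f k \<noteq> 0"
      using nz[OF w(1) i] f by (metis (no_types, lifting) atMost_iff scale_zero_left sum.neutral)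
    then have "\<theta> k = \<eta> i" using eig[of k] by simp
    then obtain c where c: "w i = c *s v k"
      using eigenvectors_proportional[OF vs(1) A vs(2,3) basis_upto_in[OF v(1) k(1)] v(2)[OF k(1)]
          nz[OF v(1) k(1)] basis_upto_in[OF w(1) i]] w(2)[OF i] by metis
    then have "c \<noteq> 0" using nz[OF w(1) i] by auto
    then show ?thesis using c k by blast
  qed
  then have "\<exists>\<sigma> c. \<forall>i\<le>d. \<sigma> i \<le> d \<and> c i \<noteq> 0 \<and> w i = c i *s v (\<sigma> i)"
    by metis
  then obtain \<sigma> c where \<sigma>: "\<And>i. i \<le> d \<Longrightarrow> \<sigma> i \<le> d" and c: "\<And>i. i \<le> d \<Longrightarrow> c i \<noteq> 0"
    and wv: "\<And>i. i \<le> d \<Longrightarrow> w i = c i *s v (\<sigma> i)"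
    by blast
  have inj: "inj_on \<sigma> {..d}"
  proof (rule inj_onI, rule ccontr)
    fix i j assume ij: "i \<in> {..d}" "j \<in> {..d}" "\<sigma> i = \<sigma> j" "i \<noteq> j"
    \<comment> \<open>Two multiples of the same \<open>v (\<sigma> i)\<close> would be linearly
      dependent.\<close>
    let ?f = "\<lambda>k. if k = i then c j else if k = j then - c i else 0"
    have "(\<Sum>k\<le>d. ?f k *s w k) = (\<Sum>k\<in>{i, j}. ?f k *s w k)"
      using ij by (intro sum.mono_neutral_right) auto
    also have "\<dots> = 0"
      using ij wv by (simp add: mult.commute)
    finally have "?f i = 0" using ij by (intro basis_upto_eq_0[OF w(1)]) auto
    then show False using c[of j] ij by simp
  qed
  then have bij: "bij_betw \<sigma> {..d} {..d}"
    using \<sigma> by (metis (no_types, lifting) atMost_iff bij_betw_def card_image card_subset_eq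
        finite_atMost image_subsetI)
  \<comment> \<open>Comparing \<open>As (w i)\<close> in both bases shows that \<open>N\<close> is
    \<open>M\<close> relabelled by \<sigma> and rescaled by \<open>c\<close>. The nonzero
    off-diagonal entries of \<open>N\<close> then force \<sigma> to preserve adjacency.\<close>
  have NM: "N k i * c k = c i * M (\<sigma> k) (\<sigma> i)" if "i \<le> d" "k \<le> d" for i k
  proof -
    have "(\<Sum>k\<le>d. N k i *s w k) = As (c i *s v (\<sigma> i))"
      using has_matrixD[OF w(3) \<open>i \<le> d\<close>] wv \<open>i \<le> d\<close> by simp
    also have "\<dots> = c i *s As (v (\<sigma> i))"
      using As basis_upto_in[OF v(1) \<sigma>] \<open>i \<le> d\<close> by (simp add: linear_between_def)
    also have "\<dots> = (\<Sum>m\<le>d. (c i * M m (\<sigma> i)) *s v m)"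
      using has_matrixD[OF v(3) \<sigma>[OF \<open>i \<le> d\<close>]] by (simp add: scale_sum_right)
    also have "\<dots> = (\<Sum>k\<le>d. (c i * M (\<sigma> k) (\<sigma> i)) *s v (\<sigma> k))"
      by (rule sum.reindex_bij_betw[OF bij, symmetric])
    also have "\<dots> = (\<Sum>k\<le>d. (c i * M (\<sigma> k) (\<sigma> i) / c k) *s w k)"
      using wv c by (intro sum.cong) auto
    finally have "N k i = c i * M (\<sigma> k) (\<sigma> i) / c k"
      using \<open>k \<le> d\<close>
      by (rule basis_upto_eqD[OF w(1), of "\<lambda>k. N k i" "\<lambda>k. c i * M (\<sigma> k) (\<sigma> i) / c k" k])
    then show ?thesis using c[OF \<open>k \<le> d\<close>] by simp
  qed
  have adj: "\<sigma> (Suc i) = Suc (\<sigma> i) \<or> \<sigma> i = Suc (\<sigma> (Suc i))" if "i < d" for i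
  proof -
    have "N (Suc i) i \<noteq> 0" using w(4) that by (simp add: irreducible_tridiagonal_def)
    then have "M (\<sigma> (Suc i)) (\<sigma> i) \<noteq> 0" using NM[of i "Suc i"] c[of "Suc i"] that by auto
    moreover have "\<sigma> (Suc i) \<noteq> \<sigma> i" using inj_onD[OF inj, of "Suc i" i] that by auto
    ultimately show ?thesis
      using v(4) \<sigma>[of i] \<sigma>[of "Suc i"] that unfolding irreducible_tridiagonal_def by fastforce
  qed
  have \<eta>: "\<eta> i = \<theta> (\<sigma> i)" if "i \<le> d" for i
  proof -
    have "\<eta> i *s w i = A (c i *s v (\<sigma> i))" using w(2) wv that by simp
    also have "\<dots> = c i *s A (v (\<sigma> i))"
      using A basis_upto_in[OF v(1) \<sigma>[OF that]] by (simp add: linear_between_def)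
    also have "\<dots> = \<theta> (\<sigma> i) *s w i" using v(2)[OF \<sigma>[OF that]] wv that by (simp add: mult.commute)
    finally show ?thesis using nz[OF w(1) that] by simp
  qed
  have "(\<forall>i\<le>d. \<sigma> i = i) \<or> (\<forall>i\<le>d. \<sigma> i = d - i)"
    using inj \<sigma> adj by (rule path_automorphism)
  then show ?thesis using \<eta> by auto
qed

text \<open>Here \<open>v\<close> carries the almost bipartite shape and \<open>w\<close> the
  Bannai/Ito condition. Their orders agree up to reversal, under which the four-term relation is
  symmetric, so it passes to \<open>v\<close>. A last reversal, if necessary, puts the nonzero
  diagonal entry at d.\<close>

lemma normalized_standard_basis:
  assumes A: "linear_between (*s) (*s) V V A" and As: "linear_between (*s) (*s) V V As"
    and d: "dim V = Suc d"
    and v: "standard_basis V A As v" "almost_bipartite_mat (matrix_wrt V v As)"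
    and w: "standard_basis V A As w" "\<forall>i\<le>d. A (w i) = \<eta> i *s w i"
      "\<forall>i. 2 \<le> i \<and> i < d \<longrightarrow> (\<eta> (i - 2) - \<eta> (i + 1)) / (\<eta> (i - 1) - \<eta> i) = - 1"
    and vs: "standard_basis V As A vs"
  obtains u \<theta> M where "basis_upto d V u" "\<forall>j\<le>d. A (u j) = \<theta> j *s u j"
    "has_matrix d u As M" "irreducible_tridiagonal d M" "\<forall>i<d. M i i = 0" "M d d \<noteq> 0"
    "\<forall>i. i + 3 \<le> d \<longrightarrow> \<theta> i + \<theta> (i + 1) = \<theta> (i + 2) + \<theta> (i + 3)"
proof -
  obtain \<theta> M where b: "basis_upto d V v" and \<theta>: "\<forall>j\<le>d. A (v j) = \<theta> j *s v j"
    and M: "has_matrix d v As M" "irreducible_tridiagonal d M"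
    using v(1) unfolding standard_basis_iff[OF A As d] by blast
  obtain N where w': "basis_upto d V w" "has_matrix d w As N" "irreducible_tridiagonal d N"
    using w(1) unfolding standard_basis_iff[OF A As d] by blast
  obtain T where vs': "basis_upto d V vs" "has_matrix d vs A T" "irreducible_tridiagonal d T"
    using vs unfolding standard_basis_iff[OF As A d] by blast
  have \<eta>: "\<eta> i + \<eta> (i + 1) = \<eta> (i + 2) + \<eta> (i + 3)" if "i + 3 \<le> d" for i
  proof -
    have "(\<eta> i - \<eta> (i + 3)) / (\<eta> (i + 1) - \<eta> (i + 2)) = - 1"
      using w(3)[rule_format, of "i + 2"] that by (simp add: numeral_3_eq_3)
    \<comment> \<open>A quotient by zero is 0 by convention, so the value -1 excludes a zero
      denominator.\<close>
    then have "\<eta> i - \<eta> (i + 3) = - (\<eta> (i + 1) - \<eta> (i + 2))"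
      by (metis divide_eq_minus_1_iff)
    then show ?thesis by (simp add: algebra_simps)
  qed
  have \<theta>_bi: "\<theta> i + \<theta> (i + 1) = \<theta> (i + 2) + \<theta> (i + 3)" if i: "i + 3 \<le> d" for i
  proof -
    consider "\<forall>i\<le>d. \<eta> i = \<theta> i" | "\<forall>i\<le>d. \<eta> i = \<theta> (d - i)"
      using standard_order_unique[OF A As b _ M w'(1) _ w'(2,3) vs'] \<theta> w(2) by blast
    then show ?thesis
    proof cases
      case 1
      then show ?thesis using \<eta>[OF i] i by simp
    next
      case 2
      \<comment> \<open>The window i, ..., i + 3 is the mirror image of j, ..., j + 3.\<close>
      define j where "j = d - (i + 3)"
      have j: "j + 3 \<le> d" "d - j = i + 3" "d - (j + 1) = i + 2" "d - (j + 2) = i + 1" "d - (j + 3) = i"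
        using i by (auto simp: j_def)
      have "\<eta> k = \<theta> (d - k)" if "k \<le> j + 3" for k
        using 2 that j(1) by (meson le_trans)
      from this[of j] this[of "j + 1"] this[of "j + 2"] this[of "j + 3"]
      have "\<eta> j = \<theta> (i + 3)" "\<eta> (j + 1) = \<theta> (i + 2)" "\<eta> (j + 2) = \<theta> (i + 1)" "\<eta> (j + 3) = \<theta> i"
        unfolding j by simp_all
      then show ?thesis using \<eta>[OF j(1)] by (simp add: add_ac)
    qed
  qed
  have M_eq: "matrix_wrt V v As $$ (i, j) = M i j" if "i \<le> d" "j \<le> d" for i j
    using matrix_wrt_eq[OF b M(1) that] .
  have ab: "(M 0 0 \<noteq> 0) \<noteq> (M d d \<noteq> 0)" "\<And>i. 1 \<le> i \<Longrightarrow> i < d \<Longrightarrow> M i i = 0"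
    using v(2) matrix_wrt_carrier[OF b, of As] by (auto simp: almost_bipartite_mat_def M_eq)
  show thesis
  proof (cases "M d d = 0")
    case False
    then have "M i i = 0" if "i < d" for i
      using ab that by (cases "i = 0") auto
    then show thesis using that[of v \<theta> M] b \<theta> M False \<theta>_bi by blast
  next
    \<comment> \<open>The nonzero corner sits at index 0, so the reversed basis is taken.\<close>
    case True
    have "M (d - i) (d - i) = 0" if "i < d" for i
      using ab(2)[of "d - i"] True that by (cases "i = 0") auto
    moreover have "\<theta> (d - i) + \<theta> (d - (i + 1)) = \<theta> (d - (i + 2)) + \<theta> (d - (i + 3))" if "i + 3 \<le> d" for i
    proof -
      have "d - i = d - (i + 3) + 3" "d - (i + 1) = d - (i + 3) + 2" "d - (i + 2) = d - (i + 3) + 1"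
        using that by auto
      then show ?thesis using \<theta>_bi[of "d - (i + 3)"] that by (simp add: add_ac)
    qed
    ultimately show thesis
      using that[of "\<lambda>i. v (d - i)" "\<lambda>i. \<theta> (d - i)" "\<lambda>i j. M (d - i) (d - j)"]
        basis_upto_reverse[OF b] \<theta> has_matrix_reverse[OF M(1)] irreducible_tridiagonal_reverse[OF M(2)]
        ab(1) True by simp
  qed
qed

end


section \<open>Canonical form of the pair, and isomorphism of pairs with equal matrices\<close>

lemma of_nat_odd_diff_neq_0:
  assumes "j \<le> d" shows "(2 * of_nat d + 1 - of_nat j :: 'a::field_char_0) \<noteq> 0"
proof -
  have "(2 * of_nat d + 1 - of_nat j :: 'a) = of_nat (2 * d + 1 - j)"
    using assms by (subst of_nat_diff) auto
  also have "\<dots> \<noteq> 0"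
    unfolding of_nat_eq_0_iff using assms by simp
  finally show ?thesis .
qed

text \<open>The traces are the corner entries of the two tridiagonal matrices, hence nonzero.
  \<open>T_prod\<close> determines the matrix of \<open>A\<close> in the eigenbasis of
  \<open>As\<close> up to conjugation by a diagonal matrix, so rescaling the basis vectors gives
  matrices that depend on \<tau> and \<tau>s alone.\<close>

lemma canonical_form:
  fixes s :: "'k::field_char_0 \<Rightarrow> 'v::ab_group_add \<Rightarrow> 'v"
  assumes "ambient_space s" and d: "3 \<le> d"
    and tab: "ambient_space.tab_bi_leonard_pair s d \<tau> \<tau>s V A As"
  shows "\<tau> \<noteq> 0" "\<tau>s \<noteq> 0"
    "\<exists>w. ambient_space.basis_upto s d V w \<and>
      ambient_space.has_matrix s d w A (\<lambda>i j. \<tau> / (of_nat d + 1) * folded_cube_entry d i j) \<and>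
      ambient_space.has_matrix s d w As
        (\<lambda>i j. if i = j then \<tau>s / (of_nat d + 1) * folded_cube_eigenvalue d j else 0)"
proof -
  interpret ambient_space s by fact
  have A: "linear_between s s V V A" and As: "linear_between s s V V As" and dim: "dim V = Suc d"
    and tr: "trace_on V A = \<tau>" "trace_on V As = \<tau>s"
    using tab by (auto simp: tab_bi_leonard_pair_def leonard_pair_def diameter_def)
  have diam: "diameter V = d" using dim by (simp add: diameter_def)
  obtain v1 vs1 where v1: "standard_basis V A As v1" "almost_bipartite_mat (matrix_wrt V v1 As)"
    and vs1: "standard_basis V As A vs1" "almost_bipartite_mat (matrix_wrt V vs1 A)"
    using tab unfolding tab_bi_leonard_pair_def totally_almost_bipartite_def by blast
  obtain v vs \<eta> \<eta>s where
    v: "standard_basis V A As v" "\<forall>i\<le>d. A (v i) = s (\<eta> i) (v i)"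
      "\<forall>i. 2 \<le> i \<and> i < d \<longrightarrow> (\<eta> (i - 2) - \<eta> (i + 1)) / (\<eta> (i - 1) - \<eta> i) = - 1" and
    vs: "standard_basis V As A vs" "\<forall>i\<le>d. As (vs i) = s (\<eta>s i) (vs i)"
      "\<forall>i. 2 \<le> i \<and> i < d \<longrightarrow> (\<eta>s (i - 2) - \<eta>s (i + 1)) / (\<eta>s (i - 1) - \<eta>s i) = - 1"
    using tab unfolding tab_bi_leonard_pair_def bannai_ito_type_def diam by blast
  obtain u \<theta> M where u: "basis_upto d V u" "\<forall>j\<le>d. A (u j) = s (\<theta> j) (u j)"
    and M: "has_matrix d u As M" "irreducible_tridiagonal d M" "\<forall>i<d. M i i = 0" "M d d \<noteq> 0"
    and \<theta>: "\<forall>i. i + 3 \<le> d \<longrightarrow> \<theta> i + \<theta> (i + 1) = \<theta> (i + 2) + \<theta> (i + 3)"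
    using normalized_standard_basis[OF A As dim v1 v vs(1)] .
  obtain us \<theta>s N where us: "basis_upto d V us" "\<forall>j\<le>d. As (us j) = s (\<theta>s j) (us j)"
    and N: "has_matrix d us A N" "irreducible_tridiagonal d N" "\<forall>i<d. N i i = 0" "N d d \<noteq> 0"
    and \<theta>s: "\<forall>i. i + 3 \<le> d \<longrightarrow> \<theta>s i + \<theta>s (i + 1) = \<theta>s (i + 2) + \<theta>s (i + 3)"
    using normalized_standard_basis[OF As A dim vs1 vs v(1)] .
  have diag: "has_matrix d u A (\<lambda>i j. if i = j then \<theta> j else 0)"
    and diags: "has_matrix d us As (\<lambda>i j. if i = j then \<theta>s j else 0)"
    using u(2) us(2) by (simp_all add: has_matrix_diagonal)
  have "(\<Sum>i\<le>d. K i i) = K d d" if "\<forall>i<d. K i i = 0" for K :: "nat \<Rightarrow> nat \<Rightarrow> 'k"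
    using that by (subst sum.mono_neutral_right[of _ "{d}"]) auto
  then have \<tau>: "\<tau> = N d d" "\<tau>s = M d d"
    using trace_on_eq[OF us(1) A N(1)] trace_on_eq[OF u(1) As M(1)] tr N(3) M(3) by simp_all
  have sum_\<theta>: "(\<Sum>i\<le>d. \<theta> i) = N d d" "(\<Sum>i\<le>d. \<theta>s i) = M d d"
    using trace_on_eq[OF u(1) A diag] trace_on_eq[OF us(1) As diags] tr \<tau> by simp_all
  obtain X Y where X: "\<forall>j\<le>d. u j = (\<Sum>i\<le>d. s (X i j) (us i))"
    and XY: "\<forall>i\<le>d. \<forall>j\<le>d. (\<Sum>k\<le>d. X i k * Y k j) = (if i = j then 1 else 0)"
    and YX: "\<forall>i\<le>d. \<forall>j\<le>d. (\<Sum>k\<le>d. Y i k * X k j) = (if i = j then 1 else 0)"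
    using change_of_basis[OF us(1) u(1)] .
  interpret sys: bannai_ito_system d N M X \<theta> \<theta>s
  proof (unfold_locales, goal_cases)
    case (12 i j)
    then show ?case
      using has_matrix_change_of_basis[OF us(1) A N(1) diag X[rule_format] 12]
      by (simp add: if_distrib[of "\<lambda>x. _ * x"] mult.commute cong: if_cong)
  next
    case (13 i j)
    then show ?case
      using has_matrix_change_of_basis[OF us(1) As diags M(1) X[rule_format] 13]
      by (simp add: if_distrib[of "\<lambda>x. x * _"] cong: if_cong)
  next
    \<comment> \<open>Both independence conditions of the locale come from the inverse
      \<open>Y\<close> of \<open>X\<close>.\<close>
    case (14 f m)
    have "f m = (\<Sum>k\<le>d. f k * (\<Sum>j\<le>d. X k j * Y j m))"
      using XY 14(2) by (simp add: if_distrib[of "\<lambda>x. _ * x"] cong: if_cong)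
    also have "\<dots> = (\<Sum>j\<le>d. (\<Sum>k\<le>d. f k * X k j) * Y j m)"
      by (simp add: sum_distrib_left sum_distrib_right mult.assoc) (rule sum.swap)
    also have "\<dots> = 0" using 14(1) by simp
    finally show ?case .
  next
    case (15 f m)
    have "f m = (\<Sum>k\<le>d. (\<Sum>i\<le>d. Y m i * X i k) * f k)"
      using YX 15(2) by (simp add: if_distrib[of "\<lambda>x. x * _"] cong: if_cong)
    also have "\<dots> = (\<Sum>i\<le>d. Y m i * (\<Sum>k\<le>d. X i k * f k))"
      by (simp add: sum_distrib_left sum_distrib_right mult.assoc) (rule sum.swap)
    also have "\<dots> = 0" using 15(1) by simp
    finally show ?case .
  qed (use d M(2-4) N(2-4) \<theta> \<theta>s sum_\<theta> in \<open>auto simp: irreducible_tridiagonal_def\<close>)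
  show nz: "\<tau> \<noteq> 0" "\<tau>s \<noteq> 0" using \<tau> N(4) M(4) by auto
  define t where "t = \<tau> / (of_nat d + 1)"
  have d1: "(of_nat d + 1 :: 'k) \<noteq> 0"
    using of_nat_neq_0[of d, where ?'a = 'k] by (simp add: add.commute)
  then have t0: "t \<noteq> 0" using nz by (simp add: t_def)
  note neq_0 = of_nat_odd_diff_neq_0[of _ d, where ?'a = 'k]
  \<comment> \<open>Chosen so that the rescaled subdiagonal entries become t (2 d + 1 - k). The
    superdiagonal ones are then right as well, since \<open>T_prod\<close> prescribes the
    products.\<close>
  define g where "g j = (\<Prod>k<j. N (Suc k) k / (t * (2 * of_nat d + 1 - of_nat k)))" for j
  have g_Suc: "g (Suc j) = g j * (N (Suc j) j / (t * (2 * of_nat d + 1 - of_nat j)))" for j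
    by (simp add: g_def)
  have g0: "g j \<noteq> 0" if "j \<le> d" for j
    using that
  proof (induction j)
    case (Suc j)
    then show ?case using sys.T_irr(2)[of j] neq_0[of j] t0 by (simp add: g_Suc)
  qed (simp add: g_def)
  have entry: "g j * N i j = t * folded_cube_entry d i j * g i" if "i \<le> d" "j \<le> d" for i j
  proof -
    consider "Suc i = j" | "i = Suc j" | "i = j" "i = d" | "i = j" "i < d"
      | "\<not> (i = j \<or> i = Suc j \<or> j = Suc i)"
      using le_neq_implies_less[OF \<open>i \<le> d\<close>] by metis
    then show ?thesis
    proof cases
      case 1
      have "g j * N i j = g i * (N i j * N j i) / (t * (2 * of_nat d + 1 - of_nat i))"
        using 1 g_Suc[of i] by simp
      also have "N i j * N j i = t\<^sup>2 * (of_nat i + 1) * (2 * of_nat d + 1 - of_nat i)"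
        using sys.T_prod[of i] 1 that \<tau> by (simp add: t_def)
      finally show ?thesis
        using 1 t0 neq_0[of i] that
        by (auto simp: folded_cube_entry_def power2_eq_square add.commute)
    next
      case 2
      then show ?thesis
        using g_Suc[of j] t0 neq_0[of j] that by (simp add: folded_cube_entry_def)
    next
      case 3
      have "N d d = t * (of_nat d + 1)" using d1 \<tau> by (simp add: t_def)
      then show ?thesis using 3 by (simp add: folded_cube_entry_def)
    next
      case 4
      then show ?thesis using N(3) by (simp add: folded_cube_entry_def)
    next
      case 5
      then show ?thesis using sys.T_tri[of i j] that by (auto simp: folded_cube_entry_def)
    qed
  qed
  let ?w = "\<lambda>i. s (g i) (us i)"
  show "\<exists>w. basis_upto d V w \<and>
      has_matrix d w A (\<lambda>i j. \<tau> / (of_nat d + 1) * folded_cube_entry d i j) \<and>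
      has_matrix d w As
        (\<lambda>i j. if i = j then \<tau>s / (of_nat d + 1) * folded_cube_eigenvalue d j else 0)"
  proof (intro exI[of _ ?w] conjI)
    show "basis_upto d V ?w" using us(1) g0 by (rule basis_upto_scale)
    show "has_matrix d ?w A (\<lambda>i j. \<tau> / (of_nat d + 1) * folded_cube_entry d i j)"
      unfolding has_matrix_def t_def[symmetric]
    proof (intro allI impI)
      fix j assume j: "j \<le> d"
      have "A (?w j) = s (g j) (A (us j))"
        using A basis_upto_in[OF us(1) j] by (simp add: linear_between_def)
      also have "\<dots> = (\<Sum>i\<le>d. s (g j * N i j) (us i))"
        unfolding has_matrixD[OF N(1) j] by (simp add: scale_sum_right)
      also have "\<dots> = (\<Sum>i\<le>d. s (t * folded_cube_entry d i j) (?w i))"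
        using entry j by (intro sum.cong) auto
      finally show "A (?w j) = \<dots>" .
    qed
    show "has_matrix d ?w As
        (\<lambda>i j. if i = j then \<tau>s / (of_nat d + 1) * folded_cube_eigenvalue d j else 0)"
      unfolding has_matrix_diagonal
    proof (intro allI impI)
      fix j assume j: "j \<le> d"
      have "As (?w j) = s (g j) (As (us j))"
        using As basis_upto_in[OF us(1) j] by (simp add: linear_between_def)
      also have "\<dots> = s (\<theta>s j) (?w j)"
        using us(2) j by (simp add: mult.commute)
      also have "\<theta>s j = \<tau>s / (of_nat d + 1) * folded_cube_eigenvalue d j"
        using sys.\<theta>s_formula[OF j] \<tau> by (simp add: folded_cube_eigenvalue_def)
      finally show "As (?w j) = s (\<tau>s / (of_nat d + 1) * folded_cube_eigenvalue d j) (?w j)" .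
    qed
  qed
qed

lemma isomorphic_if_same_matrices:
  fixes s :: "'k::field \<Rightarrow> 'v::ab_group_add \<Rightarrow> 'v" and t :: "'k \<Rightarrow> 'w::ab_group_add \<Rightarrow> 'w"
  assumes "ambient_space s" "ambient_space t"
    and v: "ambient_space.basis_upto s d V v" and w: "ambient_space.basis_upto t d W w"
    and A: "linear_between s s V V A" "ambient_space.has_matrix s d v A M"
    and As: "linear_between s s V V As" "ambient_space.has_matrix s d v As N"
    and B: "linear_between t t W W B" "ambient_space.has_matrix t d w B M"
    and Bs: "linear_between t t W W Bs" "ambient_space.has_matrix t d w Bs N"
  shows "leonard_pairs_isomorphic s t V A As W B Bs"
proof -
  interpret S: ambient_space s by fact
  interpret T: ambient_space t by fact
  define \<phi> where "\<phi> x = (\<Sum>i\<le>d. t (S.representation (v ` {..<S.dim V}) x (v i)) (w i))" for x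
  have \<phi>: "\<phi> (\<Sum>i\<le>d. s (f i) (v i)) = (\<Sum>i\<le>d. t (f i) (w i))" for f
  proof -
    let ?x = "\<Sum>i\<le>d. s (f i) (v i)"
    have "f i = S.representation (v ` {..<S.dim V}) ?x (v i)" if "i \<le> d" for i
      using S.basis_upto_eqD[OF v S.basis_upto_representation[OF v S.sum_in_basis_upto[OF v, of f]] that] .
    then show ?thesis unfolding \<phi>_def by (intro sum.cong) auto
  qed
  have expand: "\<exists>f. x = (\<Sum>i\<le>d. s (f i) (v i))" if "x \<in> V" for x
    using S.basis_upto_representation[OF v that]
    by (rule exI[of _ "\<lambda>i. S.representation (v ` {..<S.dim V}) x (v i)"])
  have expand': "\<exists>f. y = (\<Sum>i\<le>d. t (f i) (w i))" if "y \<in> W" for y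
    using T.basis_upto_representation[OF w that]
    by (rule exI[of _ "\<lambda>i. T.representation (w ` {..<T.dim W}) y (w i)"])
  have intertwines: "\<phi> (C x) = D (\<phi> x)"
    if "linear_between s s V V C" "S.has_matrix d v C P" "linear_between t t W W D" "T.has_matrix d w D P"
      "x \<in> V" for C D P x
  proof -
    obtain f where f: "x = (\<Sum>i\<le>d. s (f i) (v i))" using expand[OF \<open>x \<in> V\<close>] by blast
    show ?thesis
      unfolding f S.has_matrix_apply[OF v that(1,2)] \<phi> T.has_matrix_apply[OF w that(3,4)] ..
  qed
  have "linear_between s t V W \<phi>"
    unfolding linear_between_def
  proof (intro conjI ballI allI)
    fix x assume "x \<in> V"
    then obtain f where f: "x = (\<Sum>i\<le>d. s (f i) (v i))" using expand by blast
    show "\<phi> x \<in> W" unfolding f \<phi> by (rule T.sum_in_basis_upto[OF w])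
    show "\<phi> (s c x) = t c (\<phi> x)" for c
    proof -
      have "s c x = (\<Sum>i\<le>d. s (c * f i) (v i))" unfolding f by (simp add: S.scale_sum_right)
      then show ?thesis unfolding f \<phi> by (simp add: \<phi> T.scale_sum_right)
    qed
    fix y assume "y \<in> V"
    then obtain g where g: "y = (\<Sum>i\<le>d. s (g i) (v i))" using expand by blast
    have "x + y = (\<Sum>i\<le>d. s (f i + g i) (v i))"
      unfolding f g by (simp add: S.scale_left_distrib sum.distrib)
    then show "\<phi> (x + y) = \<phi> x + \<phi> y"
      unfolding f g \<phi> by (simp add: \<phi> T.scale_left_distrib sum.distrib)
  qed
  moreover have "bij_betw \<phi> V W"
  proof (rule bij_betw_imageI)
    show "inj_on \<phi> V"
    proof (rule inj_onI)
      fix x y assume "x \<in> V" "y \<in> V" and eq: "\<phi> x = \<phi> y"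
      then obtain f g where f: "x = (\<Sum>i\<le>d. s (f i) (v i))" and g: "y = (\<Sum>i\<le>d. s (g i) (v i))"
        using expand by meson
      have "f i = g i" if "i \<le> d" for i
        using T.basis_upto_eqD[OF w eq[unfolded f g \<phi>] that] .
      then show "x = y" unfolding f g by simp
    qed
    show "\<phi> ` V = W"
    proof (intro equalityI subsetI)
      fix y assume "y \<in> \<phi> ` V"
      then show "y \<in> W"
        using \<open>linear_between s t V W \<phi>\<close> by (auto simp: linear_between_def)
    next
      fix y assume "y \<in> W"
      then obtain f where "y = (\<Sum>i\<le>d. t (f i) (w i))" using expand' by blast
      then have "y = \<phi> (\<Sum>i\<le>d. s (f i) (v i))" by (simp add: \<phi>)
      then show "y \<in> \<phi> ` V" using S.sum_in_basis_upto[OF v] by blast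
    qed
  qed
  ultimately show ?thesis
    unfolding leonard_pairs_isomorphic_def
    using intertwines[OF A B] intertwines[OF As Bs] by blast
qed

subsection \<open>Krawtchouk polynomials and the folded cube\<close>


text \<open>For n = N - j this is the generating function, in the degree, of the characters of the
  N-cube.\<close>

definition krawtchouk_poly :: "nat \<Rightarrow> nat \<Rightarrow> 'a::comm_ring_1 poly" where
  "krawtchouk_poly j n = [:1, -1:] ^ j * [:1, 1:] ^ n"

text \<open>The logarithmic derivative G'/G = n/(1+x) - j/(1-x), multiplied by (1 - x^2) G.\<close>

lemma krawtchouk_poly_pderiv:
  fixes j n :: nat
  defines "G \<equiv> krawtchouk_poly j n :: 'a::field_char_0 poly"
  shows "[:1, 0, -1:] * pderiv G = Polynomial.smult (of_nat n - of_nat j) G - Polynomial.smult (of_nat (j + n)) (pCons 0 G)"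
proof -
  let ?p = "[:1, -1:] :: 'a poly" and ?q = "[:1, 1:] :: 'a poly"
  have power: "f * pderiv (f ^ k) = of_nat k * (f ^ k * pderiv f)" for f :: "'a poly" and k
  proof (cases k)
    case (Suc m)
    show ?thesis unfolding Suc pderiv_power_Suc of_nat_mult_conv_smult[symmetric]
      by (simp add: mult_ac del: of_nat_Suc)
  qed simp
  have d: "pderiv ?p = - 1" "pderiv ?q = 1" by (simp_all add: pderiv_pCons one_pCons)
  have pq: "[:1, 0, -1:] = ?p * ?q" by simp
  have ring: "(Q * R) * (a * (S * - 1)) + (P * S) * (b * (R * 1)) = (b * P - a * Q) * (S * R)"
    for P Q R S a b :: "'a poly" by (simp add: algebra_simps)
  have "[:1, 0, -1:] * pderiv G = (?q * ?q ^ n) * (?p * pderiv (?p ^ j)) + (?p * ?p ^ j) * (?q * pderiv (?q ^ n))"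
    unfolding pq G_def krawtchouk_poly_def by (simp only: pderiv_mult algebra_simps)
  also have "\<dots> = (of_nat n * ?p - of_nat j * ?q) * G"
    unfolding power d G_def krawtchouk_poly_def by (rule ring)
  also have "of_nat n * ?p - of_nat j * ?q = [:of_nat n - of_nat j:] - [:0, of_nat (j + n):]"
    by (simp add: of_nat_poly)
  also have "\<dots> * G = Polynomial.smult (of_nat n - of_nat j) G - Polynomial.smult (of_nat (j + n)) (pCons 0 G)"
    unfolding left_diff_distrib by simp
  finally show ?thesis .
qed

definition krawtchouk :: "nat \<Rightarrow> nat \<Rightarrow> nat \<Rightarrow> 'a::comm_ring_1" where
  "krawtchouk N i j = coeff (krawtchouk_poly j (N - j)) i"

lemma krawtchouk_0: "krawtchouk N 0 j = 1"
  by (simp add: krawtchouk_def krawtchouk_poly_def coeff_mult_0 coeff_0_power)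

text \<open>Coefficient of x^i in \<open>krawtchouk_poly_pderiv\<close>. It is the eigenvalue
  equation of the N-cube for the eigenvalue N - 2 j.\<close>

lemma krawtchouk_row:
  assumes "j \<le> N"
  shows "of_nat (Suc i) * krawtchouk N (Suc i) j + (if i = 0 then 0 else (of_nat N - of_nat (i - 1)) * krawtchouk N (i - 1) j)
    = (of_nat N - 2 * of_nat j) * (krawtchouk N i j :: 'a::field_char_0)"
proof -
  let ?G = "krawtchouk_poly j (N - j) :: 'a poly"
  have *: "[:1, 0, -1:] * H = H - pCons 0 (pCons 0 H)" for H :: "'a poly" by simp
  have "coeff (pderiv ?G - pCons 0 (pCons 0 (pderiv ?G))) i
      = coeff (Polynomial.smult (of_nat (N - j) - of_nat j) ?G - Polynomial.smult (of_nat (j + (N - j))) (pCons 0 ?G)) i"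
    using krawtchouk_poly_pderiv[of j "N - j", where ?'a = 'a] unfolding * by simp
  then show ?thesis
    using assms
    by (cases i; cases "i - 1")
      (auto simp: coeff_pderiv krawtchouk_def coeff_pCons algebra_simps split: nat.splits)
qed

text \<open>Exchanging one factor 1 - x for 1 + x, or conversely, changes the product by 2 x times
  the remaining factors, up to sign. Weighted by j and N - j these changes add up to -2 x G', so the
  left side is the coefficient of N G - 2 x G'. The truncated indices at j = 0 and j = N carry the
  weight 0.\<close>

lemma krawtchouk_col:
  assumes "j \<le> N"
  shows "of_nat j * krawtchouk N i (j - 1) + of_nat (N - j) * krawtchouk N i (Suc j)
    = (of_nat N - 2 * of_nat i) * (krawtchouk N i j :: 'a::field_char_0)"
proof -
  let ?p = "[:1, -1:] :: 'a poly" and ?q = "[:1, 1:] :: 'a poly"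
  let ?G = "\<lambda>j. krawtchouk_poly j (N - j) :: 'a poly"
  have d: "pderiv ?p = - 1" "pderiv ?q = 1" by (simp_all add: pderiv_pCons one_pCons)
  define n where "n = N - j"
  have j: "of_nat j * ?G (j - 1) = of_nat j * ?G j - 2 * (pCons 0 (?q ^ n * pderiv (?p ^ j)))"
  proof (cases j)
    case (Suc k)
    have n: "N - k = Suc n" using Suc assms by (simp add: n_def)
    have 1: "pCons 0 (?q ^ n * pderiv (?p ^ j)) = - (of_nat j * ([:0, 1:] * ?q ^ n * ?p ^ k))"
      unfolding Suc pderiv_power_Suc d of_nat_mult_conv_smult[symmetric]
      by (simp add: mult_ac del: of_nat_Suc)
    have 2: "?G (j - 1) = ?G j + 2 * ([:0, 1:] * ?q ^ n * ?p ^ k)"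
    proof -
      have "?q = ?p + 2 * [:0, 1:]" by (simp add: numeral_poly)
      moreover have "P * ((Q + 2 * x) * R) = (Q * P) * R + 2 * (x * R * P)" for P Q R x :: "'a poly"
        by (simp add: algebra_simps)
      ultimately have "?p ^ k * (?q * ?q ^ n) = (?p * ?p ^ k) * ?q ^ n + 2 * ([:0, 1:] * ?q ^ n * ?p ^ k)"
        by (simp only:)
      then show ?thesis
        unfolding krawtchouk_poly_def n_def[symmetric] using Suc n by simp
    qed
    have "a * (G + 2 * Z) = a * G - 2 * - (a * Z)" for a G Z :: "'a poly"
      by (simp add: algebra_simps)
    then show ?thesis unfolding 1 2 .
  qed simp
  have n: "of_nat n * ?G (Suc j) = of_nat n * ?G j - 2 * (pCons 0 (?p ^ j * pderiv (?q ^ n)))"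
  proof (cases n)
    case (Suc k)
    have k: "N - Suc j = k" using Suc by (simp add: n_def)
    have 1: "pCons 0 (?p ^ j * pderiv (?q ^ n)) = of_nat n * ([:0, 1:] * ?p ^ j * ?q ^ k)"
      unfolding Suc pderiv_power_Suc d of_nat_mult_conv_smult[symmetric]
      by (simp add: mult_ac del: of_nat_Suc)
    have 2: "?G (Suc j) = ?G j - 2 * ([:0, 1:] * ?p ^ j * ?q ^ k)"
    proof -
      have "?p = ?q - 2 * [:0, 1:]" by (simp add: numeral_poly)
      moreover have "((Q - 2 * x) * P) * R = P * (Q * R) - 2 * (x * P * R)" for P Q R x :: "'a poly"
        by (simp add: algebra_simps)
      ultimately have "(?p * ?p ^ j) * ?q ^ k = ?p ^ j * (?q * ?q ^ k) - 2 * ([:0, 1:] * ?p ^ j * ?q ^ k)"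
        by (simp only:)
      then show ?thesis
        unfolding krawtchouk_poly_def n_def[symmetric] k using Suc by simp
    qed
    have "a * (G - 2 * Z) = a * G - 2 * (a * Z)" for a G Z :: "'a poly"
      by (simp add: algebra_simps)
    then show ?thesis unfolding 1 2 .
  qed simp
  have "of_nat j * ?G (j - 1) + of_nat n * ?G (Suc j) = of_nat (j + n) * ?G j - 2 * pCons 0 (pderiv (?G j))"
    unfolding j n unfolding krawtchouk_poly_def n_def[symmetric] pderiv_mult
    by (simp add: algebra_simps)
  then have "coeff (of_nat j * ?G (j - 1) + of_nat n * ?G (Suc j)) i
      = coeff (of_nat (j + n) * ?G j - 2 * pCons 0 (pderiv (?G j))) i" by (rule arg_cong)
  moreover have "j + n = N" using assms by (simp add: n_def)
  moreover have "coeff (2 * pCons 0 (pderiv (?G j))) i = 2 * of_nat i * coeff (?G j) i"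
    by (cases i) (simp_all add: coeff_pderiv numeral_poly)
  ultimately show ?thesis
    by (simp add: krawtchouk_def n_def of_nat_poly algebra_simps)
qed

text \<open>Reversing the coefficients negates 1 - x and fixes 1 + x.\<close>

lemma krawtchouk_reflect:
  assumes "j \<le> N" "i \<le> N"
  shows "krawtchouk N (N - i) j = (-1) ^ j * (krawtchouk N i j :: 'a::field_char_0)"
proof -
  let ?p = "[:1, -1:] :: 'a poly" and ?q = "[:1, 1:] :: 'a poly"
  let ?G = "krawtchouk_poly j (N - j) :: 'a poly"
  have "reflect_poly ?p = - ?p" "reflect_poly ?q = ?q"
    by (simp_all add: reflect_poly_def)
  then have "reflect_poly ?G = (- ?p) ^ j * ?q ^ (N - j)"
    by (simp add: krawtchouk_poly_def reflect_poly_mult reflect_poly_power)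
  also have "\<dots> = (-1) ^ j * ?G"
    by (subst power_minus) (simp add: krawtchouk_poly_def)
  finally have r: "reflect_poly ?G = (-1) ^ j * ?G" .
  have deg: "degree ?G = N"
    using assms by (simp add: krawtchouk_poly_def degree_mult_eq degree_power_eq)
  have "coeff (reflect_poly ?G) i = coeff ?G (N - i)"
    using assms by (simp add: coeff_reflect_poly deg)
  then show ?thesis
    unfolding r krawtchouk_def by (cases "even j") auto
qed

text \<open>The substitution of -x for x exchanges the two factors.\<close>

lemma krawtchouk_flip:
  assumes "j \<le> N" shows "krawtchouk N i (N - j) = (-1) ^ i * (krawtchouk N i j :: 'a::field_char_0)"
proof -
  have power: "pcompose (f ^ n) g = pcompose f g ^ n" for f g :: "'a poly" and n
    by (induction n) (simp_all add: pcompose_mult pcompose_1)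
  have "krawtchouk_poly (N - j) j = pcompose (krawtchouk_poly j (N - j) :: 'a poly) [:0, -1:]"
    by (simp add: krawtchouk_poly_def pcompose_mult power pcompose_pCons mult.commute)
  then show ?thesis using assms by (simp add: krawtchouk_def coeff_pcompose_linear)
qed

text \<open>For j \<le> 2 d + 1 the sign replaces j by whichever of j and 2 d + 1 - j is even, by
  \<open>krawtchouk_flip\<close>. Characters of even weight are those that agree on antipodal
  vertices, hence live on the folded cube.\<close>

definition cube_char :: "nat \<Rightarrow> nat \<Rightarrow> nat \<Rightarrow> 'a::comm_ring_1" where
  "cube_char d i j = (-1) ^ (i * j) * krawtchouk (2 * d + 1) i j"

lemma cube_char_0: "cube_char d 0 j = 1"
  by (simp add: cube_char_def krawtchouk_0)

text \<open>The fold: index d + 1 is identified with d. This, and its analogue for columns, accounts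
  for the diagonal entry d + 1 of the folded cube.\<close>

lemma cube_char_Suc_row:
  assumes "j \<le> d"
  shows "cube_char d (Suc d) j = (cube_char d d j :: 'a::field_char_0)"
  using krawtchouk_reflect[of j "2 * d + 1" d, where ?'a = 'a] assms
  by (simp add: cube_char_def power_add mult_ac flip: power_mult_distrib)

lemma cube_char_Suc_col:
  "cube_char d i (Suc d) = (cube_char d i d :: 'a::field_char_0)"
  using krawtchouk_flip[of d "2 * d + 1" i, where ?'a = 'a]
  by (simp add: cube_char_def power_add mult_ac flip: power_mult_distrib)

text \<open>\<open>krawtchouk_row\<close> with signs: moving i by one changes the sign by (-1)^j,
  which is the sign in the eigenvalue.\<close>

lemma folded_cube_mult_cube_char:
  assumes "i \<le> d" "j \<le> d"
  shows "(\<Sum>k\<le>d. folded_cube_entry d i k * cube_char d k j)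
    = folded_cube_eigenvalue d j * (cube_char d i j :: 'a::field_char_0)"
proof -
  let ?N = "2 * d + 1"
  have "(\<Sum>k\<le>d. folded_cube_entry d i k * cube_char d k j :: 'a)
      = (if i = 0 then 0 else folded_cube_entry d i (i - 1) * cube_char d (i - 1) j)
        + folded_cube_entry d i i * cube_char d i j
        + (if i = d then 0 else folded_cube_entry d i (Suc i) * cube_char d (Suc i) j)"
    by (rule sum_tridiagonal) (use assms in \<open>auto simp: folded_cube_entry_def\<close>)
  \<comment> \<open>At i = d the diagonal entry supplies the term of index
    \<open>Suc d\<close>.\<close>
  also have "\<dots> = of_nat (Suc i) * cube_char d (Suc i) j
      + (if i = 0 then 0 else (of_nat ?N - of_nat (i - 1)) * cube_char d (i - 1) j)"
    using assms cube_char_Suc_row[of j d, where ?'a = 'a]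
    by (cases i) (auto simp: folded_cube_entry_def)
  also have "\<dots> = (-1) ^ j * (-1) ^ (i * j) * (of_nat (Suc i) * krawtchouk ?N (Suc i) j
      + (if i = 0 then 0 else (of_nat ?N - of_nat (i - 1)) * krawtchouk ?N (i - 1) j))"
  proof -
    have "(-1) ^ ((i - 1) * j) = ((-1) ^ j * (-1) ^ (i * j) :: 'a)" if "i \<noteq> 0"
      using that by (cases i) (auto simp: power_add simp flip: mult.assoc power_mult_distrib)
    then show ?thesis
      by (simp add: cube_char_def power_add algebra_simps)
  qed
  also have "\<dots> = (-1) ^ j * (-1) ^ (i * j) * ((of_nat ?N - 2 * of_nat j) * krawtchouk ?N i j)"
    using krawtchouk_row[of j ?N i, where ?'a = 'a] assms by simp
  finally show ?thesis
    by (simp add: cube_char_def folded_cube_eigenvalue_def mult_ac)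
qed

text \<open>The self-duality: the table diagonalizes the folded cube from the other side too, with
  the same eigenvalues in the same order. \<open>krawtchouk_col\<close> and the fold of the columns
  take the place of their row versions.\<close>

lemma cube_char_mult_folded_cube:
  assumes "i \<le> d" "j \<le> d"
  shows "(\<Sum>k\<le>d. cube_char d i k * folded_cube_entry d k j)
    = folded_cube_eigenvalue d i * (cube_char d i j :: 'a::field_char_0)"
proof -
  let ?N = "2 * d + 1"
  have "(\<Sum>k\<le>d. cube_char d i k * folded_cube_entry d k j :: 'a)
      = (if j = 0 then 0 else cube_char d i (j - 1) * folded_cube_entry d (j - 1) j)
        + cube_char d i j * folded_cube_entry d j j
        + (if j = d then 0 else cube_char d i (Suc j) * folded_cube_entry d (Suc j) j)"
    by (rule sum_tridiagonal) (use assms in \<open>auto simp: folded_cube_entry_def\<close>)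
  also have "\<dots> = of_nat j * cube_char d i (j - 1) + (of_nat ?N - of_nat j) * cube_char d i (Suc j)"
    using assms cube_char_Suc_col[of d i, where ?'a = 'a]
    by (cases j) (auto simp: folded_cube_entry_def algebra_simps)
  also have "\<dots> = (-1) ^ i * (-1) ^ (i * j) * (of_nat j * krawtchouk ?N i (j - 1)
      + of_nat (?N - j) * krawtchouk ?N i (Suc j))"
  proof -
    have sign: "(-1) ^ (i * (j - 1)) = ((-1) ^ i * (-1) ^ (i * j) :: 'a)" if "j \<noteq> 0"
      using that by (cases j) (auto simp: power_add simp flip: mult.assoc power_mult_distrib)
    have N: "(of_nat (?N - j) :: 'a) = of_nat ?N - of_nat j"
      using assms by (intro of_nat_diff) simp
    show ?thesis
      unfolding N by (cases "j = 0") (use sign in \<open>simp_all add: cube_char_def power_add algebra_simps\<close>)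
  qed
  also have "\<dots> = (-1) ^ i * (-1) ^ (i * j) * ((of_nat ?N - 2 * of_nat i) * krawtchouk ?N i j)"
    using krawtchouk_col[of j ?N i, where ?'a = 'a] assms by simp
  finally show ?thesis
    by (simp add: cube_char_def folded_cube_eigenvalue_def mult_ac)
qed

text \<open>Indices of different parity would need i + j = 2 d + 1, which exceeds 2 d.
  Characteristic zero reduces the question to integers.\<close>

lemma folded_cube_eigenvalue_inj:
  assumes "i \<le> d" "j \<le> d"
    and eq: "folded_cube_eigenvalue d i = (folded_cube_eigenvalue d j :: 'a::field_char_0)"
  shows "i = j"
proof -
  have "(of_int (folded_cube_eigenvalue d k) :: 'a) = folded_cube_eigenvalue d k" for k
    by (simp add: folded_cube_eigenvalue_def)
  then have "(folded_cube_eigenvalue d i :: int) = folded_cube_eigenvalue d j"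
    using eq by (metis of_int_eq_iff)
  then show ?thesis
    using assms(1,2) by (cases "even i"; cases "even j") (auto simp: folded_cube_eigenvalue_def)
qed

text \<open>The columns are eigenvectors for distinct eigenvalues. Applying the folded cube n times
  to a relation multiplies each coefficient by the n-th power of its eigenvalue, so any polynomial
  in the eigenvalues may be inserted.\<close>

lemma cube_char_independent:
  fixes f :: "nat \<Rightarrow> 'a::field_char_0"
  assumes 0: "\<And>i. i \<le> d \<Longrightarrow> (\<Sum>j\<le>d. f j * cube_char d i j) = 0" and "m \<le> d"
  shows "f m = 0"
proof -
  let ?\<theta> = "folded_cube_eigenvalue d :: nat \<Rightarrow> 'a"
  have moment: "(\<Sum>j\<le>d. f j * ?\<theta> j ^ n * cube_char d i j) = 0" if "i \<le> d" for i n
    using that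
  proof (induction n arbitrary: i)
    case (Suc n)
    have "(\<Sum>j\<le>d. f j * ?\<theta> j ^ Suc n * cube_char d i j)
        = (\<Sum>j\<le>d. \<Sum>k\<le>d. folded_cube_entry d i k * (f j * ?\<theta> j ^ n * cube_char d k j))"
    proof (rule sum.cong[OF refl])
      fix j assume "j \<in> {..d}"
      then have "f j * ?\<theta> j ^ Suc n * cube_char d i j
          = f j * ?\<theta> j ^ n * (\<Sum>k\<le>d. folded_cube_entry d i k * cube_char d k j)"
        using folded_cube_mult_cube_char[OF Suc.prems, of j, where ?'a = 'a] by simp
      then show "f j * ?\<theta> j ^ Suc n * cube_char d i j
          = (\<Sum>k\<le>d. folded_cube_entry d i k * (f j * ?\<theta> j ^ n * cube_char d k j))"
        by (simp only: sum_distrib_left mult.left_commute)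
    qed
    also have "\<dots> = (\<Sum>k\<le>d. folded_cube_entry d i k * (\<Sum>j\<le>d. f j * ?\<theta> j ^ n * cube_char d k j))"
      by (subst sum.swap) (simp only: sum_distrib_left)
    also have "\<dots> = 0" using Suc.IH by simp
    finally show ?case .
  qed (use 0 in simp)
  have poly0: "(\<Sum>j\<le>d. f j * poly P (?\<theta> j)) = 0" for P
  proof -
    \<comment> \<open>Row 0 of the table is constantly 1.\<close>
    have "(\<Sum>j\<le>d. f j * poly P (?\<theta> j)) = (\<Sum>n\<le>degree P. coeff P n * (\<Sum>j\<le>d. f j * ?\<theta> j ^ n * cube_char d 0 j))"
      unfolding poly_altdef sum_distrib_left by (subst sum.swap) (simp add: cube_char_0 mult_ac)
    then show ?thesis using moment by simp
  qed
  \<comment> \<open>The Lagrange polynomial of the node with index \<open>m\<close>, up to a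
    constant.\<close>
  define P where "P = (\<Prod>k\<in>{..d} - {m}. [:- ?\<theta> k, 1:])"
  have P: "poly P (?\<theta> j) = (\<Prod>k\<in>{..d} - {m}. ?\<theta> j - ?\<theta> k)" for j
    by (simp add: P_def poly_prod)
  have "poly P (?\<theta> j) = 0" if "j \<le> d" "j \<noteq> m" for j
    unfolding P using that by (intro prod_zero) auto
  then have "f m * poly P (?\<theta> m) = (\<Sum>j\<le>d. f j * poly P (?\<theta> j))"
    using \<open>m \<le> d\<close> by (subst sum.mono_neutral_right[of _ "{m}"]) auto
  moreover have "poly P (?\<theta> m) \<noteq> 0"
    unfolding P using folded_cube_eigenvalue_inj[of m d, where ?'a = 'a] \<open>m \<le> d\<close> by auto
  ultimately show ?thesis using poly0 by simp
qed

text \<open>The consecutive sums are 2 t and -2 t in turn; distinctness keeps the denominator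
  nonzero.\<close>

lemma folded_cube_eigenvalue_bannai_ito:
  assumes "2 \<le> i" "i < d" and "t \<noteq> (0 :: 'a::field_char_0)"
  defines "\<theta> \<equiv> \<lambda>i. t * folded_cube_eigenvalue d i"
  shows "(\<theta> (i - 2) - \<theta> (i + 1)) / (\<theta> (i - 1) - \<theta> i) = - 1"
proof -
  obtain k where k: "i = k + 2" using assms(1) by (metis add.commute le_Suc_ex)
  have "\<theta> (i - 1) \<noteq> \<theta> i"
    using folded_cube_eigenvalue_inj[of "k + 1" d "k + 2", where ?'a = 'a] assms(2,3)
    unfolding \<theta>_def k by auto
  moreover have "\<theta> (i - 2) - \<theta> (i + 1) = - (\<theta> (i - 1) - \<theta> i)"
    unfolding k \<theta>_def folded_cube_eigenvalue_def by (simp add: algebra_simps)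
  ultimately show ?thesis by (simp add: divide_eq_minus_1_iff)
qed

lemma irreducible_tridiagonal_folded_cube:
  assumes "t \<noteq> (0 :: 'a::field_char_0)"
  shows "irreducible_tridiagonal d (\<lambda>i j. t * folded_cube_entry d i j)"
  unfolding irreducible_tridiagonal_def
proof (intro conjI allI impI)
  fix i assume "i < d"
  then show "t * folded_cube_entry d i (Suc i) \<noteq> 0" "t * folded_cube_entry d (Suc i) i \<noteq> 0"
    using assms of_nat_neq_0[of i, where ?'a = 'a] of_nat_odd_diff_neq_0[of i d, where ?'a = 'a]
    by (auto simp: folded_cube_entry_def simp del: of_nat_Suc)
qed (auto simp: folded_cube_entry_def)

subsection \<open>Existence and uniqueness\<close>


context ambient_space
begin

lemma basis_upto_if_independent:
  assumes w: "basis_upto d V w" and in_V: "\<And>i. i \<le> d \<Longrightarrow> v i \<in> V"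
    and ind: "\<And>f i. (\<Sum>i\<le>d. f i *s v i) = 0 \<Longrightarrow> i \<le> d \<Longrightarrow> f i = 0"
  shows "basis_upto d V v"
proof -
  have v: "inj_on v {..d}" "independent (v ` {..d})"
    by (rule independent_family, erule ind, assumption)+
  have V: "subspace V" "dim V = Suc d"
    using basis_upto_subspace[OF w] w by (auto simp: basis_upto_def)
  obtain B where B: "v ` {..d} \<subseteq> B" "B \<subseteq> V" "independent B" "V \<subseteq> span B"
    using maximal_independent_subset_extend[of "v ` {..d}" V] v(2) in_V by blast
  have "card B = Suc d"
    using basis_card_eq_dim[OF B(2,4,3)] V by simp
  then have "finite B" by (metis card.infinite nat.distinct(1))
  then have "v ` {..d} = B"
    using B(1) \<open>card B = Suc d\<close> card_image[OF v(1)] by (intro card_subset_eq) auto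
  then have "span (v ` {..d}) = V"
    using B V(1) by (metis span_minimal subset_antisym)
  then show ?thesis
    using v V by (simp add: basis_upto_def indexed_basis_def lessThan_Suc_atMost)
qed

end

text \<open>The columns of the character table U are the coordinates of the second basis. With F the
  folded cube and E its diagonal eigenvalue matrix, F U = U E makes that basis diagonalize
  \<open>A\<close>, and U F = E U gives \<open>As\<close> the matrix ts F in it.\<close>

lemma tab_bi_leonard_pair_folded_cube:
  fixes s :: "'k::field_char_0 \<Rightarrow> 'v::ab_group_add \<Rightarrow> 'v"
  assumes "ambient_space s" and "1 \<le> d" and nz: "t \<noteq> 0" "ts \<noteq> 0"
    and w: "ambient_space.basis_upto s d V w"
    and A: "linear_between s s V V A" "ambient_space.has_matrix s d w A (\<lambda>i j. t * folded_cube_entry d i j)"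
    and As: "linear_between s s V V As"
      "ambient_space.has_matrix s d w As (\<lambda>i j. if i = j then ts * folded_cube_eigenvalue d j else 0)"
  shows "ambient_space.tab_bi_leonard_pair s d (t * (of_nat d + 1)) (ts * (of_nat d + 1)) V A As"
proof -
  interpret ambient_space s by fact
  let ?F = "folded_cube_entry d :: nat \<Rightarrow> nat \<Rightarrow> 'k" and ?\<theta> = "folded_cube_eigenvalue d :: nat \<Rightarrow> 'k"
    and ?U = "cube_char d :: nat \<Rightarrow> nat \<Rightarrow> 'k"
  define v where "v j = (\<Sum>i\<le>d. s (?U i j) (w i))" for j
  have comb: "(\<Sum>j\<le>d. s (f j) (v j)) = (\<Sum>i\<le>d. s (\<Sum>j\<le>d. f j * ?U i j) (w i))" for f
    by (simp add: v_def scale_sum_left scale_sum_right) (rule sum.swap)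
  have v: "basis_upto d V v"
  proof (rule basis_upto_if_independent[OF w])
    show "v i \<in> V" if "i \<le> d" for i unfolding v_def by (rule sum_in_basis_upto[OF w])
    fix f i assume 0: "(\<Sum>i\<le>d. s (f i) (v i)) = 0" "i \<le> d"
    then show "f i = 0"
      using basis_upto_eq_0[OF w, of "\<lambda>i. \<Sum>j\<le>d. f j * ?U i j"] unfolding comb
      by (intro cube_char_independent[of d f]) auto
  qed
  have Av: "\<forall>j\<le>d. A (v j) = s (t * ?\<theta> j) (v j)"
  proof (intro allI impI)
    fix j assume j: "j \<le> d"
    have "A (v j) = (\<Sum>i\<le>d. s (\<Sum>k\<le>d. t * ?F i k * ?U k j) (w i))"
      unfolding v_def by (rule has_matrix_apply[OF w A])
    also have "\<dots> = (\<Sum>i\<le>d. s (t * ?\<theta> j * ?U i j) (w i))"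
      using folded_cube_mult_cube_char[OF _ j, where ?'a = 'k]
      by (intro sum.cong refl) (simp add: mult.assoc flip: sum_distrib_left)
    finally show "A (v j) = s (t * ?\<theta> j) (v j)" by (simp add: v_def scale_sum_right)
  qed
  have Asv: "has_matrix d v As (\<lambda>i j. ts * ?F i j)"
    unfolding has_matrix_def
  proof (intro allI impI)
    fix j assume j: "j \<le> d"
    have "As (v j) = (\<Sum>i\<le>d. s (\<Sum>k\<le>d. (if i = k then ts * ?\<theta> k else 0) * ?U k j) (w i))"
      unfolding v_def by (rule has_matrix_apply[OF w As])
    also have "\<dots> = (\<Sum>i\<le>d. s (\<Sum>k\<le>d. ts * ?F k j * ?U i k) (w i))"
    proof (rule sum.cong[OF refl])
      fix i assume "i \<in> {..d}"
      then have "(\<Sum>k\<le>d. (if i = k then ts * ?\<theta> k else 0) * ?U k j) = ts * (?\<theta> i * ?U i j)"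
        by (simp add: if_distrib[of "\<lambda>x. x * _"] mult.assoc cong: if_cong)
      also have "\<dots> = (\<Sum>k\<le>d. ts * ?F k j * ?U i k)"
        using cube_char_mult_folded_cube[of i d j, where ?'a = 'k] \<open>i \<in> {..d}\<close> j
        by (simp add: sum_distrib_left mult_ac flip: cube_char_mult_folded_cube)
      finally show "s (\<Sum>k\<le>d. (if i = k then ts * ?\<theta> k else 0) * ?U k j) (w i)
          = s (\<Sum>k\<le>d. ts * ?F k j * ?U i k) (w i)" by simp
    qed
    finally show "As (v j) = (\<Sum>k\<le>d. s (ts * ?F k j) (v k))" unfolding comb .
  qed
  have Asw: "\<forall>j\<le>d. As (w j) = s (ts * ?\<theta> j) (w j)"
    using As(2) by (simp add: has_matrix_diagonal)
  have dim: "dim V = Suc d" and V: "subspace V"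
    using w basis_upto_subspace by (auto simp: basis_upto_def)
  have sv: "standard_basis V A As v"
    unfolding standard_basis_iff[OF A(1) As(1) dim]
    by (intro conjI v exI[of _ "\<lambda>j. t * ?\<theta> j"] Av exI[of _ "\<lambda>i j. ts * ?F i j"] Asv
        irreducible_tridiagonal_folded_cube nz)
  have sw: "standard_basis V As A w"
    unfolding standard_basis_iff[OF As(1) A(1) dim]
    by (intro conjI w exI[of _ "\<lambda>j. ts * ?\<theta> j"] Asw exI[of _ "\<lambda>i j. t * ?F i j"] A(2)
        irreducible_tridiagonal_folded_cube nz)
  \<comment> \<open>The corner d + 1 is the only nonzero diagonal entry; 1 \<le> d keeps it apart
    from the entry at 0.\<close>
  have ab: "almost_bipartite_mat (matrix_wrt V u L)"
    if u: "basis_upto d V u" and L: "has_matrix d u L (\<lambda>i j. c * ?F i j)" and "c \<noteq> 0"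
      "standard_basis V K L u"
    for u L K c
  proof -
    have "tridiagonal_mat (matrix_wrt V u L)"
      using that(4) by (auto simp: standard_basis_def irreducible_tridiagonal_mat_def)
    moreover have "(of_nat d + 1 :: 'k) \<noteq> 0"
      using of_nat_neq_0[of d, where ?'a = 'k] by (simp add: add.commute)
    ultimately show ?thesis
      using matrix_wrt_carrier[OF u, of L] matrix_wrt_eq[OF u L] \<open>c \<noteq> 0\<close> \<open>1 \<le> d\<close>
      by (auto simp: almost_bipartite_mat_def folded_cube_entry_def)
  qed
  have "(\<Sum>i\<le>d. t * ?F i i) = (\<Sum>i\<in>{d}. t * ?F i i)"
    by (rule sum.mono_neutral_right) (auto simp: folded_cube_entry_def)
  then have trA: "trace_on V A = t * (of_nat d + 1)"
    using trace_on_eq[OF w A] by (simp add: folded_cube_entry_def)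
  have "trace_on V As = ts * (\<Sum>i\<le>d. ?\<theta> i)"
    using trace_on_eq[OF w As] by (simp add: sum_distrib_left)
  then have trAs: "trace_on V As = ts * (of_nat d + 1)"
    by (simp add: folded_cube_eigenvalue_def sum_alternating_odd)
  have diam: "diameter V = d"
    using dim by (simp add: diameter_def)
  have "leonard_pair V A As"
    unfolding leonard_pair_def using V dim A(1) As(1) sv sw by auto
  moreover have "totally_almost_bipartite V A As"
    unfolding totally_almost_bipartite_def
    using sv sw ab[OF v Asv nz(2) sv] ab[OF w A(2) nz(1) sw] by blast
  moreover have "bannai_ito_type V A As"
    unfolding bannai_ito_type_def diam
    by (intro exI[of _ v] exI[of _ w] exI[of _ "\<lambda>i. t * ?\<theta> i"] exI[of _ "\<lambda>i. ts * ?\<theta> i"]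
        conjI sv sw Av Asw allI impI folded_cube_eigenvalue_bannai_ito nz) simp_all
  ultimately show ?thesis
    unfolding tab_bi_leonard_pair_def using diam trA trAs by simp
qed

lemma tab_bi_leonard_pair_exists:
  fixes \<tau> \<tau>s :: "'k::field_char_0"
  assumes "1 \<le> d" "\<tau> \<noteq> 0" "\<tau>s \<noteq> 0"
  shows "\<exists>(V :: (nat \<Rightarrow> 'k) set) A As.
    ambient_space.tab_bi_leonard_pair seq_scale d \<tau> \<tau>s V A As"
proof -
  interpret ambient_space "seq_scale :: 'k \<Rightarrow> (nat \<Rightarrow> 'k) \<Rightarrow> _"
    by (simp add: ambient_space_def vector_space_seq_scale)
  let ?V = "{f :: nat \<Rightarrow> 'k. \<forall>n>d. f n = 0}"
  define w :: "nat \<Rightarrow> nat \<Rightarrow> 'k" where "w i = (\<lambda>n. if n = i then 1 else 0)" for i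
  \<comment> \<open>The map with matrix \<open>M\<close> on sequences supported in {0..d}; the
    cut-off keeps its values in \<open>?V\<close>.\<close>
  define L where "L M f = (\<lambda>i. if i \<le> d then \<Sum>k\<le>d. M i k * f k else 0)"
    for M :: "nat \<Rightarrow> nat \<Rightarrow> 'k" and f
  have sum_apply: "(\<Sum>i\<in>I. g i) n = (\<Sum>i\<in>I. g i n)" for g :: "nat \<Rightarrow> nat \<Rightarrow> 'k" and I n
    by (induction I rule: infinite_finite_induct) auto
  have comb: "(\<Sum>i\<le>d. seq_scale (f i) (w i)) = (\<lambda>n. if n \<le> d then f n else 0)" for f
    by (rule ext) (simp add: sum_apply seq_scale_def w_def if_distrib[of "\<lambda>x. _ * x"] cong: if_cong)
  have w: "basis_upto d ?V w"
  proof (rule basis_uptoI)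
    show "subspace ?V" by (rule subspaceI) (auto simp: seq_scale_def)
    show "w i \<in> ?V" if "i \<le> d" for i using that by (simp add: w_def)
    show "f i = 0" if "(\<Sum>i\<le>d. seq_scale (f i) (w i)) = 0" "i \<le> d" for f i
      using fun_cong[OF that(1), of i] that(2) unfolding comb by simp
    show "\<exists>f. x = (\<Sum>i\<le>d. seq_scale (f i) (w i))" if "x \<in> ?V" for x
      unfolding comb using that by (intro exI[of _ x]) (auto simp: fun_eq_iff)
  qed
  have lin: "linear_between seq_scale seq_scale ?V ?V (L M)" for M
    by (auto simp: linear_between_def L_def seq_scale_def fun_eq_iff sum.distrib sum_distrib_left
        algebra_simps)
  have mat: "has_matrix d w (L M) M" for M
    unfolding has_matrix_def comb
    by (auto simp: L_def w_def fun_eq_iff if_distrib[of "\<lambda>x. _ * x"] cong: if_cong)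
  have d1: "(of_nat d + 1 :: 'k) \<noteq> 0"
    using of_nat_neq_0[of d, where ?'a = 'k] by (simp add: add.commute)
  have "tab_bi_leonard_pair d (\<tau> / (of_nat d + 1) * (of_nat d + 1)) (\<tau>s / (of_nat d + 1) * (of_nat d + 1))
    ?V (L (\<lambda>i j. \<tau> / (of_nat d + 1) * folded_cube_entry d i j))
    (L (\<lambda>i j. if i = j then \<tau>s / (of_nat d + 1) * folded_cube_eigenvalue d j else 0))"
    using assms d1 by (intro tab_bi_leonard_pair_folded_cube[OF ambient_space_axioms _ _ _ w lin mat lin mat]) auto
  then show ?thesis using d1 by auto
qed

theorem theorem8p19:
  fixes d :: nat
    and \<tau> \<tau>s :: "'k :: {alg_closed_field, field_char_0}"
    and scaleV :: "'k \<Rightarrow> 'v::ab_group_add \<Rightarrow> 'v"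
    and scaleW :: "'k \<Rightarrow> 'w::ab_group_add \<Rightarrow> 'w"
  assumes "d \<ge> 3"
    and "vector_space scaleV"
    and "vector_space scaleW"
  shows
    "((\<exists>(V :: (nat \<Rightarrow> 'k) set) A As.
         ambient_space.tab_bi_leonard_pair seq_scale d \<tau> \<tau>s V A As)
        \<longleftrightarrow> \<tau> \<noteq> 0 \<and> \<tau>s \<noteq> 0) \<and>
     ((\<exists>V A As. ambient_space.tab_bi_leonard_pair scaleV d \<tau> \<tau>s V A As)
        \<longrightarrow> \<tau> \<noteq> 0 \<and> \<tau>s \<noteq> 0) \<and>
     (\<forall>V A As W B Bs.
        ambient_space.tab_bi_leonard_pair scaleV d \<tau> \<tau>s V A As \<longrightarrow>
        ambient_space.tab_bi_leonard_pair scaleW d \<tau> \<tau>s W B Bs \<longrightarrow>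
        leonard_pairs_isomorphic scaleV scaleW V A As W B Bs)"
proof -
  have V: "ambient_space scaleV" and W: "ambient_space scaleW"
    and seq: "ambient_space (seq_scale :: 'k \<Rightarrow> (nat \<Rightarrow> 'k) \<Rightarrow> _)"
    using assms(2,3) vector_space_seq_scale by (simp_all add: ambient_space_def)
  have linear: "linear_between s s U U C \<and> linear_between s s U U D"
    if "ambient_space s" "ambient_space.tab_bi_leonard_pair s d \<tau> \<tau>s U C D"
    for s :: "'k \<Rightarrow> 'u::ab_group_add \<Rightarrow> 'u" and U C D
    using that(2) unfolding ambient_space.tab_bi_leonard_pair_def[OF that(1)]
      ambient_space.leonard_pair_def[OF that(1)] by blast
  \<comment> \<open>Both pairs have canonical bases with the same matrices, which \<tau> and \<tau>s
    determine.\<close>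
  have iso: "leonard_pairs_isomorphic scaleV scaleW U A As X B Bs"
    if 1: "ambient_space.tab_bi_leonard_pair scaleV d \<tau> \<tau>s U A As"
      and 2: "ambient_space.tab_bi_leonard_pair scaleW d \<tau> \<tau>s X B Bs" for U A As X B Bs
    using canonical_form(3)[OF V assms(1) 1] canonical_form(3)[OF W assms(1) 2]
      linear[OF V 1] linear[OF W 2] isomorphic_if_same_matrices[OF V W] by blast
  show ?thesis
    using canonical_form(1,2)[OF seq assms(1)] canonical_form(1,2)[OF V assms(1)]
      tab_bi_leonard_pair_exists[of d \<tau> \<tau>s] assms(1) iso by fastforce
qed

end
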